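(* Consider the three-layer delayed hierarchical system described in the context, with interlayer delays $\tau_2,\tau_3\ge0$. Then, for every initial value $x^{(1)}_0$, \[ \lim_{t\to\infty}x^{(1)}(t)=\frac{\mathbf{1}\mathbf{1}^TK}{\mathbf{1}^TK\mathbf{1}}\,x^{(1)}_0,\qquad K=\mathrm{diag}(a_1,\dots,a_{N^{(1)}}), \] if and only if all roots $s\in\mathbb{C}$ of the characteristic equation \[ \det\!\Big(sI+L^{(1)}+e^{-2\tau_2 s}L^{(2)}+e^{-2(\tau_2+\tau_3)s}L^{(3)}\Big)=0, \] other than a single root at $s=0$, lie in the open left half-plane.
   Context: Three-layer hierarchical structure ($M=3$). Fix positive integers $N^{(1)},N^{(2)},N^{(3)}$ and set $N^{(4)}:=1$. For each $l\in\{1,2,3\}$ the $N^{(l)}$ nodes of layer $l$ are partitioned into $N^{(l+1)}$ groups $G^{(l)}_1,\dots,G^{(l)}_{N^{(l+1)}}$ of sizes $k^{(l)}_p\ge1$, numbered consecutively: group $G^{(l)}_p$ consists of nodes $\sum_{m<p}k^{(l)}_m+1,\dots,\sum_{m\le p}k^{(l)}_m$ of layer $l$; group $G^{(l)}_p$ ($l\le2$) is subordinate to node $p$ of layer $l+1$. Each group carries a connected undirected graph with binary adjacency matrix; $L^{(l)}_p$ is its Laplacian, $L^{(l)}_D=\mathrm{diag}(L^{(l)}_1,\dots,L^{(l)}_{N^{(l+1)}})$. Weights: positive constants $a_1,\dots,a_{N^{(1)}}$; $a^{(1)}_i=a_i$, $a^{(l+1)}_p=\sum_{i\in G^{(l)}_p}a^{(l)}_i$;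 $K^{(l)}=\mathrm{diag}(a^{(l)}_1,\dots,a^{(l)}_{N^{(l)}})^{-1}$. For $l=1,2$: $B^{(l)}=\mathrm{diag}(\mathbf{1}_{k^{(l)}_1},\dots,\mathbf{1}_{k^{(l)}_{N^{(l+1)}}})\in\mathbb{R}^{N^{(l)}\times N^{(l+1)}}$ ($\mathbf 1_k$ all-ones column vector), $C^{(l)}=\mathrm{diag}(C^{(l)}_1,\dots,C^{(l)}_{N^{(l+1)}})\in\mathbb{R}^{N^{(l+1)}\times N^{(l)}}$ with each row vector $C^{(l)}_p$ having nonnegative entries summing to $1$. $L^{(1)}=K^{(1)}L^{(1)}_D$, $L^{(2)}=B^{(1)}K^{(2)}L^{(2)}_DC^{(1)}$, $L^{(3)}=B^{(1)}B^{(2)}K^{(3)}L^{(3)}_DC^{(2)}C^{(1)}$. Delayed system ($\tau_2$ is the communication delay between layers 1 and 2, $\tau_3$ between layers 2 and 3): $\dot x^{(1)}(t)=-K^{(1)}L^{(1)}_Dx^{(1)}(t)+y^{(1)}(t)$, $x^{(2)}(t)=C^{(1)}x^{(1)}(t-\tau_2)$, $y^{(1)}(t)=B^{(1)}\big[-K^{(2)}L^{(2)}_Dx^{(2)}(t-\tau_2)+y^{(2)}(t-\tau_2)\big]$, $x^{(3)}(t)=C^{(2)}x^{(2)}(t-\tau_3)$, $y^{(2)}(t)=B^{(2)}\big[-K^{(3)}L^{(3)}_Dx^{(3)}(t-\tau_3)\big]$, with $x^{(1)}(0)=x^{(1)}_0$ and all signals taken to be zero at negative time arguments (so that delayed signals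 have Laplace transforms $e^{-\tau s}X(s)$). *)

theory Defs
  imports "HOL-Analysis.Analysis" "Jordan_Normal_Form.Determinant"
begin

text \<open>Nodes of every layer are numbered from 0. A partition of the nodes of a layer into
  consecutive groups is given by the list ks of group sizes; group p (p < length ks)
  consists of the nodes i with sum of the first p sizes \<le> i < sum of the first p+1 sizes.\<close>

definition in_grp :: "nat list \<Rightarrow> nat \<Rightarrow> nat \<Rightarrow> bool" where
  "in_grp ks p i \<longleftrightarrow> p < length ks \<and> sum_list (take p ks) \<le> i \<and> i < sum_list (take (Suc p) ks)"

definition valid_partition :: "nat list \<Rightarrow> nat \<Rightarrow> bool" where
  "valid_partition ks N \<longleftrightarrow> (\<forall>k \<in> set ks. k \<ge> 1) \<and> sum_list ks = N"

definition group_graphs :: "nat list \<Rightarrow> (nat \<Rightarrow> nat \<Rightarrow> bool) \<Rightarrow> bool" where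
  "group_graphs ks A \<longleftrightarrow>
     (\<forall>i j. A i j \<longrightarrow> A j i) \<and>
     (\<forall>i j. A i j \<longrightarrow> (\<exists>p. in_grp ks p i \<and> in_grp ks p j)) \<and>
     (\<forall>p i j. in_grp ks p i \<and> in_grp ks p j \<longrightarrow> A\<^sup>*\<^sup>* i j)"

text \<open>Block-diagonal Laplacian L_D = diag(L_1,...,L_m) of the group graphs of a layer
  with N nodes (since edges only join nodes of the same group, the Laplacian of the
  whole adjacency relation is exactly the block-diagonal matrix of group Laplacians).\<close>
definition laplacian :: "nat \<Rightarrow> (nat \<Rightarrow> nat \<Rightarrow> bool) \<Rightarrow> real mat" where
  "laplacian N A = mat N N (\<lambda>(i,j).
      if i = j then (\<Sum>l<N. if l \<noteq> i \<and> A i l then 1 else 0)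
      else (if A i j then -1 else 0))"

definition agg_weight :: "nat list \<Rightarrow> nat \<Rightarrow> (nat \<Rightarrow> real) \<Rightarrow> nat \<Rightarrow> real" where
  "agg_weight ks N a p = (\<Sum>i<N. if in_grp ks p i then a i else 0)"

definition Kmat :: "nat \<Rightarrow> (nat \<Rightarrow> real) \<Rightarrow> real mat" where
  "Kmat N a = mat N N (\<lambda>(i,j). if i = j then 1 / a i else 0)"

definition Bmat :: "nat list \<Rightarrow> nat \<Rightarrow> real mat" where
  "Bmat ks N = mat N (length ks) (\<lambda>(i,p). if in_grp ks p i then 1 else 0)"

definition valid_C :: "nat list \<Rightarrow> nat \<Rightarrow> real mat \<Rightarrow> bool" where
  "valid_C ks N C \<longleftrightarrow> C \<in> carrier_mat (length ks) N \<and>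
     (\<forall>p<length ks. \<forall>i<N. C $$ (p,i) \<ge> 0 \<and> (\<not> in_grp ks p i \<longrightarrow> C $$ (p,i) = 0)) \<and>
     (\<forall>p<length ks. (\<Sum>i<N. C $$ (p,i)) = 1)"

text \<open>The delayed hierarchical system. The state equation for x^(1) is understood in
  integral (Caratheodory) form on [0,\<infinity>), since the delayed inputs are only piecewise
  continuous; all signals vanish at negative times.\<close>
definition delayed_solution ::
  "real mat \<Rightarrow> real mat \<Rightarrow> real mat \<Rightarrow> real mat \<Rightarrow> real mat \<Rightarrow> real mat \<Rightarrow>
   real mat \<Rightarrow> real mat \<Rightarrow> real mat \<Rightarrow> real mat \<Rightarrow> real \<Rightarrow> real \<Rightarrow>
   nat \<Rightarrow> nat \<Rightarrow> nat \<Rightarrow> real vec \<Rightarrow>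
   (real \<Rightarrow> real vec) \<Rightarrow> (real \<Rightarrow> real vec) \<Rightarrow> (real \<Rightarrow> real vec) \<Rightarrow>
   (real \<Rightarrow> real vec) \<Rightarrow> (real \<Rightarrow> real vec) \<Rightarrow> bool" where
  "delayed_solution K1 LD1 K2 LD2 K3 LD3 B1 B2 C1 C2 \<tau>2 \<tau>3 N1 N2 N3 x0 x1 x2 x3 y1 y2 \<longleftrightarrow>
     (\<forall>t. x1 t \<in> carrier_vec N1 \<and> y1 t \<in> carrier_vec N1 \<and> x2 t \<in> carrier_vec N2 \<and>
          y2 t \<in> carrier_vec N2 \<and> x3 t \<in> carrier_vec N3) \<and>
     (\<forall>t<0. x1 t = 0\<^sub>v N1 \<and> y1 t = 0\<^sub>v N1 \<and> x2 t = 0\<^sub>v N2 \<and> y2 t = 0\<^sub>v N2 \<and> x3 t = 0\<^sub>v N3) \<and>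
     x1 0 = x0 \<and>
     (\<forall>t\<ge>0. \<forall>i<N1.
        ((\<lambda>s. ((- (K1 * LD1)) *\<^sub>v x1 s + y1 s) $ i) has_integral (x1 t $ i - x0 $ i)) {0..t}) \<and>
     (\<forall>t\<ge>0. x2 t = C1 *\<^sub>v x1 (t - \<tau>2)) \<and>
     (\<forall>t\<ge>0. y1 t = B1 *\<^sub>v ((- (K2 * LD2)) *\<^sub>v x2 (t - \<tau>2) + y2 (t - \<tau>2))) \<and>
     (\<forall>t\<ge>0. x3 t = C2 *\<^sub>v x2 (t - \<tau>3)) \<and>
     (\<forall>t\<ge>0. y2 t = B2 *\<^sub>v ((- (K3 * LD3)) *\<^sub>v x3 (t - \<tau>3)))"

definition char_fun :: "nat \<Rightarrow> real mat \<Rightarrow> real mat \<Rightarrow> real mat \<Rightarrow> real \<Rightarrow> real \<Rightarrow> complex \<Rightarrow> complex" where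
  "char_fun N L1 L2 L3 \<tau>2 \<tau>3 s = det (s \<cdot>\<^sub>m 1\<^sub>m N + map_mat complex_of_real L1
      + exp (- 2 * complex_of_real \<tau>2 * s) \<cdot>\<^sub>m map_mat complex_of_real L2
      + exp (- 2 * complex_of_real (\<tau>2 + \<tau>3) * s) \<cdot>\<^sub>m map_mat complex_of_real L3)"

end

theory Submission
  imports Defs "HOL-Complex_Analysis.Complex_Analysis" "HOL-Real_Asymp.Real_Asymp"
    "HOL-Probability.Discrete_Topology"
begin

text \<open>Eliminating the auxiliary signals leaves the retarded equation
  \<open>x' t = - (\<Sum>k. L k (x (t - d k)))\<close> with zero history, where every \<open>L k\<close> annihilates the all-ones vector and is
  annihilated from the left by the weights \<open>a\<close>. Let \<open>\<Delta> s = s I + (\<Sum>k. exp (- d k s) L k)\<close> and let \<open>D s\<close> be \<open>\<Delta> s\<close>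
  with its first row replaced by \<open>a\<close>. Since \<open>a \<Delta> s = s a\<close>, we have \<open>a 0 * det (\<Delta> s) = s * det (D s)\<close>, so the condition
  on the roots says that \<open>det (D s) \<noteq> 0\<close> for \<open>Re s \<ge> 0\<close>.

  If \<open>w\<close> is a left null vector of \<open>\<Delta> s\<close> and \<open>x\<close> converges to \<open>c\<close> times the all-ones vector, then the Laplace transform
  over \<open>[0, T]\<close> shows that \<open>exp (s T) * (w \<bullet> x 0)\<close> converges to \<open>c\<close> times the sum of the entries of \<open>w\<close>;
  for \<open>Re s \<ge> 0\<close> and all initial values this forces \<open>w = 0\<close>, or, when \<open>s = 0\<close>, \<open>w\<close> proportional to \<open>a\<close>.

  Conversely, subtract the constant solution so that \<open>a \<bullet> x 0 = 0\<close>. Then \<open>F s = inverse (D s) b\<close>, where \<open>b\<close> is \<open>x 0\<close> with its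
  first entry replaced by 0, extends the Laplace transform of \<open>x\<close> holomorphically to a half-plane \<open>Re s > - \<epsilon>\<close> and is
  \<open>O (1 / |s|)\<close> there. Newman's contour argument, applied on circles centred at the exponential growth rate
  of \<open>x\<close>, shows that the integral of \<open>x\<close> over \<open>[0, T]\<close> converges to \<open>F 0\<close> without any a priori bound on \<open>x\<close>, and the
  integrated equation gives \<open>x t \<longlonglongrightarrow> x 0 - \<Delta> 0 (F 0) = 0\<close>.\<close>

section \<open>A Tauberian theorem for the truncated Laplace transform\<close>

definition right_arc :: "real \<Rightarrow> real \<Rightarrow> real \<Rightarrow> complex" where
  "right_arc c R = part_circlepath (of_real c) R (- (pi/2)) (pi/2)"

definition left_arc :: "real \<Rightarrow> real \<Rightarrow> real \<Rightarrow> complex" where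
  "left_arc c R = part_circlepath (of_real c) R (pi/2) (3*pi/2)"

lemma valid_path_right_arc [simp]: "valid_path (right_arc c R)"
  and valid_path_left_arc [simp]: "valid_path (left_arc c R)"
  by (simp_all add: right_arc_def left_arc_def)

lemma cis_3pi2: "cis (3 * pi / 2) = - \<i>"
  using cis_mult[of pi "pi/2"] by (simp add: field_simps)

lemma right_arc_ends [simp]:
  "pathstart (right_arc c R) = Complex c (- R)" "pathfinish (right_arc c R) = Complex c R"
  unfolding right_arc_def pathstart_part_circlepath pathfinish_part_circlepath cis_conv_exp[symmetric]
  by (simp_all add: complex_eq_iff)

lemma left_arc_ends [simp]:
  "pathstart (left_arc c R) = Complex c R" "pathfinish (left_arc c R) = Complex c (- R)"
  unfolding left_arc_def pathstart_part_circlepath pathfinish_part_circlepath cis_conv_exp[symmetric] cis_3pi2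
  by (simp_all add: complex_eq_iff)

lemma path_image_right_arc:
  assumes "R > 0" "w \<in> path_image (right_arc c R)"
  shows "norm (w - of_real c) = R" "Re w \<ge> c"
proof -
  obtain x where x: "x \<in> {-(pi/2)..pi/2}" "w = of_real c + of_real R * cis x"
    using assms by (auto simp: right_arc_def path_image_part_circlepath' closed_segment_eq_real_ivl)
  show "norm (w - of_real c) = R" using assms x by (simp add: norm_mult)
  show "Re w \<ge> c" using assms x cos_ge_zero[of x] by simp
qed

lemma path_image_left_arc:
  assumes "R > 0" "w \<in> path_image (left_arc c R)"
  shows "norm (w - of_real c) = R" "Re w \<le> c"
proof -
  obtain x where x: "x \<in> {pi/2..3*pi/2}" "w = of_real c + of_real R * cis x"
    using assms by (auto simp: left_arc_def path_image_part_circlepath' closed_segment_eq_real_ivl)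
  show "norm (w - of_real c) = R" using assms x by (simp add: norm_mult)
  have "cos (x - pi) \<ge> 0" using x by (intro cos_ge_zero) auto
  then show "Re w \<le> c" using assms x by (simp add: mult_nonneg_nonpos)
qed

text \<open>The winding number is read off the branches \<open>Ln w\<close> on the right and \<open>Ln (- w)\<close> on the left.\<close>
lemma winding_number_closed_right_arc:
  assumes "c > 0" "R > 0" and \<gamma>: "valid_path \<gamma>" "pathstart \<gamma> = Complex c R" "pathfinish \<gamma> = Complex c (- R)"
    and avoid: "path_image \<gamma> \<inter> \<real>\<^sub>\<ge>\<^sub>0 = {}"
  shows "winding_number (right_arc c R +++ \<gamma>) 0 = 1"
    and "0 \<notin> path_image (right_arc c R +++ \<gamma>)"
proof -
  let ?p = "Complex c R" and ?q = "Complex c (- R)"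
  have r: "((\<lambda>w. 1 / w) has_contour_integral (Ln ?p - Ln ?q)) (right_arc c R)"
  proof -
    have "((\<lambda>w. 1 / w) has_contour_integral
        (Ln (pathfinish (right_arc c R)) - Ln (pathstart (right_arc c R)))) (right_arc c R)"
    proof (rule contour_integral_primitive[of "{w. Re w > 0}"])
      show "(Ln has_field_derivative 1 / w) (at w within {w. Re w > 0})" if "w \<in> {w. Re w > 0}" for w
        using that by (auto intro!: derivative_eq_intros simp: complex_nonpos_Reals_iff inverse_eq_divide)
      show "path_image (right_arc c R) \<subseteq> {w. Re w > 0}"
        using path_image_right_arc(2)[OF \<open>R > 0\<close>] \<open>c > 0\<close> by fastforce
    qed auto
    then show ?thesis by simp
  qed
  have l: "((\<lambda>w. 1 / w) has_contour_integral (Ln (- ?q) - Ln (- ?p))) \<gamma>"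
  proof -
    have "((\<lambda>w. 1 / w) has_contour_integral (Ln (- pathfinish \<gamma>) - Ln (- pathstart \<gamma>))) \<gamma>"
    proof (rule contour_integral_primitive[of "- \<real>\<^sub>\<ge>\<^sub>0" "\<lambda>w. Ln (- w)"])
      show "((\<lambda>w. Ln (- w)) has_field_derivative 1 / w) (at w within - \<real>\<^sub>\<ge>\<^sub>0)" if "w \<in> - \<real>\<^sub>\<ge>\<^sub>0" for w
      proof -
        have "- w \<notin> \<real>\<^sub>\<le>\<^sub>0" "w \<noteq> 0"
          using that by (auto simp: complex_nonpos_Reals_iff complex_nonneg_Reals_iff)
        then show ?thesis
          by (auto intro!: derivative_eq_intros simp: divide_simps)
      qed
      show "path_image \<gamma> \<subseteq> - \<real>\<^sub>\<ge>\<^sub>0" using avoid by auto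
    qed (use \<gamma> in auto)
    then show ?thesis using \<gamma> by simp
  qed
  have s: "Ln ?p - Ln ?q + (Ln (- ?q) - Ln (- ?p)) = 2 * pi * \<i>"
    using \<open>c > 0\<close> \<open>R > 0\<close> by (simp add: Ln_minus complex_eq_iff)
  have "((\<lambda>w. 1 / (w - 0)) has_contour_integral (2 * pi * \<i>)) (right_arc c R +++ \<gamma>)"
    using has_contour_integral_join[OF r l] s \<gamma> by simp
  moreover show 0: "0 \<notin> path_image (right_arc c R +++ \<gamma>)"
    using path_image_right_arc[OF \<open>R > 0\<close>, of 0 c] \<open>c > 0\<close> avoid \<gamma> by (auto simp: path_image_join)
  ultimately show "winding_number (right_arc c R +++ \<gamma>) 0 = 1"
    using winding_number_valid_path[of "right_arc c R +++ \<gamma>" 0] \<gamma>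
    by (simp add: contour_integral_unique)
qed

text \<open>The closing path is left arbitrary because the same right arc is closed in two ways: by
  the left arc for the entire truncated transform, and by three sides of a rectangle for
  \<open>F\<close>, which is holomorphic only on a half-plane. A closing path off the nonnegative
  reals passes to the left of the origin, so the loop winds once around it.\<close>

lemma Cauchy_formula_closed_right_arc:
  assumes "c > 0" "R > 0" and \<gamma>: "valid_path \<gamma>" "pathstart \<gamma> = Complex c R" "pathfinish \<gamma> = Complex c (- R)"
    and avoid: "path_image \<gamma> \<inter> \<real>\<^sub>\<ge>\<^sub>0 = {}"
    and S: "convex S" "open S" "f holomorphic_on S" "0 \<in> S"
    and im: "path_image (right_arc c R) \<subseteq> S" "path_image \<gamma> \<subseteq> S"
  shows "(\<lambda>w. f w / w) contour_integrable_on right_arc c R"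
    and "(\<lambda>w. f w / w) contour_integrable_on \<gamma>"
    and "contour_integral (right_arc c R) (\<lambda>w. f w / w) + contour_integral \<gamma> (\<lambda>w. f w / w) = 2 * pi * \<i> * f 0"
proof -
  note w = winding_number_closed_right_arc[OF \<open>c > 0\<close> \<open>R > 0\<close> \<gamma> avoid]
  have "((\<lambda>w. f w / (w - 0)) has_contour_integral
          (2 * pi * \<i> * winding_number (right_arc c R +++ \<gamma>) 0 * f 0)) (right_arc c R +++ \<gamma>)"
  proof (rule Cauchy_integral_formula_convex_simple[OF S(1,3)])
    show "path_image (right_arc c R +++ \<gamma>) \<subseteq> S - {0}"
      using w(2) im \<gamma> by (auto simp: path_image_join)
  qed (use S \<gamma> in \<open>auto simp: interior_open\<close>)
  then have i: "((\<lambda>w. f w / w) has_contour_integral 2 * pi * \<i> * f 0) (right_arc c R +++ \<gamma>)"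
    using w(1) by simp
  show 1: "(\<lambda>w. f w / w) contour_integrable_on right_arc c R"
    and 2: "(\<lambda>w. f w / w) contour_integrable_on \<gamma>"
    using has_contour_integral_integrable[OF i] contour_integrable_joinD1 contour_integrable_joinD2 \<gamma>
      valid_path_right_arc by blast+
  show "contour_integral (right_arc c R) (\<lambda>w. f w / w) + contour_integral \<gamma> (\<lambda>w. f w / w) = 2 * pi * \<i> * f 0"
    using contour_integral_join[OF 1 2] i \<gamma> by (simp add: contour_integral_unique)
qed

section \<open>Truncated Laplace transforms and the contour estimate\<close>

definition trunc_laplace :: "(real \<Rightarrow> real) \<Rightarrow> real \<Rightarrow> complex \<Rightarrow> complex" where
  "trunc_laplace x T s = integral {0..T} (\<lambda>t. exp (- s * of_real t) * of_real (x t))"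

lemma trunc_laplace_integrable:
  assumes "continuous_on {0..} x" "0 \<le> u"
  shows "(\<lambda>t. exp (- s * of_real t) * of_real (x t) :: complex) integrable_on {u..v}"
proof -
  have "continuous_on {u..v} x" by (rule continuous_on_subset[OF assms(1)]) (use assms in auto)
  then show ?thesis by (intro integrable_continuous_real continuous_intros)
qed

text \<open>The interval of integration is bounded, so differentiation under the integral sign is
  possible at every \<open>s\<close>; hence the left arc may reach arbitrarily far to the
  left.\<close>

lemma trunc_laplace_holomorphic:
  assumes "continuous_on {0..} x"
  shows "trunc_laplace x T holomorphic_on UNIV"
proof -
  have "continuous_on {0..T} x" by (rule continuous_on_subset[OF assms(1)]) auto
  then have c: "continuous_on (UNIV \<times> {0..T}) (\<lambda>z :: complex \<times> real. x (snd z))"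
    by (rule continuous_on_compose2) (auto intro: continuous_intros)
  have "(\<lambda>s. integral (cbox 0 T) (\<lambda>t. exp (- s * of_real t) * of_real (x t))) holomorphic_on UNIV"
  proof (rule leibniz_rule_holomorphic[where fx = "\<lambda>s t. - of_real t * exp (- s * of_real t) * of_real (x t)"])
    show "continuous_on (UNIV \<times> cbox 0 T) (\<lambda>(s, t). - complex_of_real t * exp (- s * complex_of_real t) * complex_of_real (x t))"
      using c by (auto simp: split_beta intro!: continuous_intros)
  qed (use trunc_laplace_integrable[OF assms] in \<open>auto intro!: derivative_eq_intros simp: algebra_simps\<close>)
  then show ?thesis by (simp add: trunc_laplace_def[abs_def])
qed

text \<open>The growth bound is integrated over \<open>{T..T'}\<close>. The quotient by
  \<open>c - Re s\<close> is meaningful on both sides of the line \<open>Re s = c\<close>: to the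
  right of it \<open>T'\<close> will tend to infinity, to the left of it the lower end will be
  0.\<close>

lemma trunc_laplace_diff_bound:
  assumes x: "continuous_on {0..} x" and B: "\<And>t. t \<ge> 0 \<Longrightarrow> \<bar>x t\<bar> \<le> B * exp (c * t)"
    and T: "0 \<le> T" "T \<le> T'" and s: "Re s \<noteq> c"
  shows "norm (trunc_laplace x T' s - trunc_laplace x T s) \<le> B * (exp ((c - Re s) * T') - exp ((c - Re s) * T)) / (c - Re s)"
proof -
  let ?f = "\<lambda>t. exp (- s * of_real t) * of_real (x t) :: complex"
  have "trunc_laplace x T' s = trunc_laplace x T s + integral {T..T'} ?f"
    unfolding trunc_laplace_def by (rule Henstock_Kurzweil_Integration.integral_combine[symmetric]) (use T trunc_laplace_integrable[OF x] in auto)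
  moreover have I: "((\<lambda>t. B * exp ((c - Re s) * t)) has_integral
      (B * exp ((c - Re s) * T') / (c - Re s) - B * exp ((c - Re s) * T) / (c - Re s))) {T..T'}"
    using s T by (intro fundamental_theorem_of_calculus)
      (auto intro!: derivative_eq_intros simp: divide_simps simp flip: has_real_derivative_iff_has_vector_derivative)
  have "norm (integral {T..T'} ?f) \<le> integral {T..T'} (\<lambda>t. B * exp ((c - Re s) * t))"
  proof (rule integral_norm_bound_integral[OF trunc_laplace_integrable[OF x T(1)] has_integral_integrable[OF I]])
    fix t assume "t \<in> {T..T'}"
    then have "\<bar>x t\<bar> \<le> B * exp (c * t)" using T B by auto
    then have "exp (- (Re s * t)) * \<bar>x t\<bar> \<le> exp (- (Re s * t)) * (B * exp (c * t))"
      by (intro mult_left_mono) auto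
    also have "\<dots> = B * exp ((c - Re s) * t)" by (simp add: algebra_simps exp_diff exp_minus divide_simps)
    finally show "norm (?f t) \<le> B * exp ((c - Re s) * t)" by (simp add: norm_mult)
  qed
  ultimately show ?thesis using integral_unique[OF I] by (simp add: algebra_simps diff_divide_distrib)
qed

text \<open>On the circle \<open>R\<^sup>2 = z * cnj z\<close> for \<open>z = s - c\<close>, so the
  factor equals \<open>z * (z + cnj z) / R\<^sup>2\<close>. The resulting
  \<open>\<bar>Re s - c\<bar>\<close> cancels the pole at \<open>Re s = c\<close> in the bounds for
  the transforms.\<close>

lemma norm_newman_factor:
  assumes "R > 0" "norm (s - of_real c) = R"
  shows "norm (1 + (s - of_real c)\<^sup>2 / (of_real R)\<^sup>2) = 2 * \<bar>Re s - c\<bar> / R"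
proof -
  define z where "z = s - of_real c"
  have z: "norm z = R" using assms by (simp add: z_def)
  have "(of_real R)\<^sup>2 = z * cnj z" by (metis complex_norm_square z of_real_power)
  then have "1 + z\<^sup>2 / (of_real R)\<^sup>2 = z * (z + cnj z) / (of_real R)\<^sup>2"
    using assms z by (auto simp: field_simps power2_eq_square)
  also have "\<dots> = z * of_real (2 * Re z) / (of_real R)\<^sup>2" by (simp only: complex_add_cnj)
  also have "norm \<dots> = 2 * \<bar>Re z\<bar> / R"
    using z assms(1) by (simp add: norm_mult norm_divide norm_power power2_eq_square)
  finally show ?thesis by (simp add: z_def)
qed

text \<open>Newman's contour argument. The factor \<open>1 + (s - c)\<^sup>2 / R\<^sup>2\<close> vanishes where the circle meets the
  line of absolute convergence; letting \<open>R\<close> tend to infinity leaves only the line \<open>Re s = - \<epsilon>\<close>.\<close>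
lemma trunc_laplace_error_bound:
  assumes x: "continuous_on {0..} x" and B: "\<And>t. t \<ge> 0 \<Longrightarrow> \<bar>x t\<bar> \<le> B * exp (c * t)" and c: "c > 0"
    and \<epsilon>: "0 < \<epsilon>" "\<epsilon> < \<epsilon>'" and F: "F holomorphic_on {s. Re s > - \<epsilon>'}"
    and C: "\<And>s. Re s \<ge> - \<epsilon> \<Longrightarrow> norm (F s) * (1 + norm s) \<le> C"
    and lim: "\<And>s. Re s > c \<Longrightarrow> ((\<lambda>T. trunc_laplace x T s) \<longlongrightarrow> F s) at_top"
    and T: "T \<ge> 0"
  shows "norm (trunc_laplace x T 0 - F 0) \<le> 3 * C / (2 * \<epsilon>) * exp (- \<epsilon> * T)"
proof -
  have B0: "B \<ge> 0" using B[of 0] by auto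
  have C0: "C \<ge> 0" using C[of 0] \<epsilon> by (auto intro: order_trans[rotated])
  have Fle: "norm (F s) \<le> C" if "Re s \<ge> - \<epsilon>" for s
    using C[OF that] by (smt (verit) mult_left_mono norm_ge_zero mult_cancel_left1)
  \<comment> \<open>To the right of the line the difference bound survives the limit
    \<open>T' \<rightarrow> \<infinity>\<close>, in which the truncated transform becomes
    \<open>F\<close>.\<close>
  have tail: "norm (F s - trunc_laplace x T s) \<le> B * exp ((c - Re s) * T) / (Re s - c)" if "Re s > c" for s
  proof (rule tendsto_upperbound)
    show "((\<lambda>T'. norm (trunc_laplace x T' s - trunc_laplace x T s)) \<longlongrightarrow> norm (F s - trunc_laplace x T s)) at_top"
      by (intro tendsto_intros lim that)
    show "\<forall>\<^sub>F T' in at_top. norm (trunc_laplace x T' s - trunc_laplace x T s) \<le> B * exp ((c - Re s) * T) / (Re s - c)"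
      using eventually_ge_at_top[of T]
    proof eventually_elim
      case (elim T')
      have "norm (trunc_laplace x T' s - trunc_laplace x T s) \<le> B * (exp ((c - Re s) * T') - exp ((c - Re s) * T)) / (c - Re s)"
        using trunc_laplace_diff_bound[OF x B T elim, of s] that by simp
      also have "\<dots> = B * (exp ((c - Re s) * T) - exp ((c - Re s) * T')) / (Re s - c)"
        using that by (simp add: divide_simps) (simp add: algebra_simps)
      also have "\<dots> \<le> B * exp ((c - Re s) * T) / (Re s - c)"
        using that B0 by (intro divide_right_mono mult_left_mono) auto
      finally show ?case .
    qed
  qed simp
  \<comment> \<open>The transform over \<open>{0..0}\<close> is 0, so here the difference bound
    controls the truncated transform itself.\<close>
  have head: "norm (trunc_laplace x T s) \<le> B * exp ((c - Re s) * T) / (c - Re s)" if "Re s < c" for s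
  proof -
    have "norm (trunc_laplace x T s - trunc_laplace x 0 s) \<le> B * (exp ((c - Re s) * T) - 1) / (c - Re s)"
      using trunc_laplace_diff_bound[OF x B order_refl T, of s] that by simp
    also have "\<dots> \<le> B * exp ((c - Re s) * T) / (c - Re s)"
      using that B0 by (intro divide_right_mono mult_left_mono) auto
    finally show ?thesis by (simp add: trunc_laplace_def)
  qed
  \<comment> \<open>The summands account, in this order, for the two arcs, the two horizontal
    segments and the vertical segment on \<open>Re s = - \<epsilon>\<close>. Only the last one
    survives as \<open>R\<close> tends to infinity.\<close>
  define E where "E R = 4 * pi * B * exp (c * T) / (R - c) + 6 * C * exp (c * T) * (c + \<epsilon>) / R
      + 3 * pi * C * exp (- \<epsilon> * T) / \<epsilon>" for R
  \<comment> \<open>\<open>R > c\<close> puts the origin inside the circle; the additional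
    \<open>\<epsilon>\<close> keeps the distance from \<open>Re s = - \<epsilon>\<close> to
    \<open>Re s = c\<close> below \<open>R\<close>, which bounds \<open>m\<close> on the
    rectangle.\<close>
  have main: "norm (2 * pi * (trunc_laplace x T 0 - F 0)) \<le> E R" if R: "R > c + \<epsilon>" for R
  proof -
    have R0: "R > 0" "R > c" using R c \<epsilon> by auto
    define m where "m s = 1 + (s - of_real c)\<^sup>2 / (of_real R)\<^sup>2" for s :: complex
    define G where "G s = exp (s * of_real T) * m s" for s
    have G: "G holomorphic_on S" for S
      unfolding G_def m_def using R0 by (intro holomorphic_intros) auto
    let ?r = "right_arc c R" and ?l = "left_arc c R"
    let ?f = "\<lambda>s. trunc_laplace x T s * G s" and ?g = "\<lambda>s. F s * G s"
    let ?a = "Complex c R" and ?b = "Complex (- \<epsilon>) R" and ?a' = "Complex c (- R)" and ?b' = "Complex (- \<epsilon>) (- R)"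
    \<comment> \<open>For \<open>F\<close> the left arc is replaced by three sides of a rectangle
      that stays inside the half-plane where \<open>F\<close> is holomorphic.\<close>
    define \<gamma> where "\<gamma> = linepath ?a ?b +++ linepath ?b ?b' +++ linepath ?b' ?a'"
    have seg1: "closed_segment ?a ?b \<subseteq> {s. Im s = R \<and> - \<epsilon> \<le> Re s \<and> Re s \<le> c}"
     and seg3: "closed_segment ?b' ?a' \<subseteq> {s. Im s = - R \<and> - \<epsilon> \<le> Re s \<and> Re s \<le> c}"
     and seg2: "closed_segment ?b ?b' \<subseteq> {s. Re s = - \<epsilon> \<and> \<bar>Im s\<bar> \<le> R}"
      using c \<epsilon> R0
      by (auto simp: closed_segment_same_Im closed_segment_same_Re closed_segment_eq_real_ivl)
    have \<gamma>im: "path_image \<gamma> = closed_segment ?a ?b \<union> closed_segment ?b ?b' \<union> closed_segment ?b' ?a'"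
      unfolding \<gamma>_def by (auto simp: path_image_join)
    have 1: "?f holomorphic_on UNIV" 
      by (intro holomorphic_intros trunc_laplace_holomorphic x G)
    have 2: "?g holomorphic_on {s. Re s > - \<epsilon>'}"
      by (intro holomorphic_intros F G)
    \<comment> \<open>A real point of the left arc must be \<open>c - R\<close>, which is
      negative.\<close>
    have lavoid: "path_image ?l \<inter> \<real>\<^sub>\<ge>\<^sub>0 = {}"
    proof (rule ccontr)
      assume "\<not> ?thesis"
      then obtain w where that: "w \<in> path_image ?l" and "w \<in> \<real>\<^sub>\<ge>\<^sub>0" by auto
      then obtain r where r: "w = of_real r" "r \<ge> 0" by (auto simp: nonneg_Reals_def)
      have "\<bar>r - c\<bar> = R"
        using path_image_left_arc(1)[OF R0(1) that] r(1) by (metis norm_of_real of_real_diff)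
      with path_image_left_arc(2)[OF R0(1) that] r R0 c show False by simp
    qed
    note i1 = Cauchy_formula_closed_right_arc[OF c R0(1) valid_path_left_arc left_arc_ends lavoid
        convex_UNIV open_UNIV 1 UNIV_I subset_UNIV subset_UNIV]
    have gavoid: "path_image \<gamma> \<inter> \<real>\<^sub>\<ge>\<^sub>0 = {}"
      using seg1 seg2 seg3 \<epsilon> R0 unfolding \<gamma>im by (auto simp: complex_nonneg_Reals_iff)
    have hs: "convex {s. Re s > - \<epsilon>'}" "open {s. Re s > - \<epsilon>'}"
      by (simp_all add: convex_halfspace_Re_gt open_halfspace_Re_gt)
    have rim: "path_image ?r \<subseteq> {s. Re s > - \<epsilon>'}"
      using path_image_right_arc(2)[OF R0(1)] c \<epsilon> by fastforce
    have gim: "path_image \<gamma> \<subseteq> {s. Re s > - \<epsilon>'}"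
      using seg1 seg2 seg3 \<epsilon> unfolding \<gamma>im by fastforce
    have v\<gamma>: "valid_path \<gamma>" "pathstart \<gamma> = ?a" "pathfinish \<gamma> = ?a'"
      unfolding \<gamma>_def by auto
    have "0 \<in> {s. Re s > - \<epsilon>'}" using \<epsilon> by simp
    note i2 = Cauchy_formula_closed_right_arc[OF c R0(1) v\<gamma> gavoid hs 2 this rim gim]
    let ?F = "\<lambda>s. F s * G s / s"
    have int: "?F contour_integrable_on linepath ?a ?b" "?F contour_integrable_on linepath ?b ?b'"
       "?F contour_integrable_on linepath ?b' ?a'"
      using i2(2) unfolding \<gamma>_def by (auto simp: contour_integrable_join)
    have split: "contour_integral \<gamma> ?F = contour_integral (linepath ?a ?b) ?F
        + (contour_integral (linepath ?b ?b') ?F + contour_integral (linepath ?b' ?a') ?F)"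
      unfolding \<gamma>_def using int by (simp add: contour_integrable_join)
    \<comment> \<open>The two Cauchy formulas are subtracted. The right arc then carries only the
      difference of the transforms, the left arc only the truncated transform, and the rectangle
      only \<open>F\<close>.\<close>
    have eq: "2 * pi * \<i> * ((trunc_laplace x T 0 - F 0) * G 0)
      = contour_integral ?r (\<lambda>s. trunc_laplace x T s * G s / s - F s * G s / s)
        + contour_integral ?l (\<lambda>s. trunc_laplace x T s * G s / s)
        - (contour_integral (linepath ?a ?b) ?F
        + (contour_integral (linepath ?b ?b') ?F + contour_integral (linepath ?b' ?a') ?F))"
    proof -
      have gen: "z * ((p - q) * g) = (a - b) + l - h"
        if "a + l = z * (p * g)" "b + h = z * (q * g)" for z p q g a b l h :: complex
        using that by (simp add: algebra_simps)
      show ?thesis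
        unfolding split[symmetric]
        by (subst contour_integral_diff[OF i1(1) i2(1)]) (rule gen, fact i1(3), fact i2(3))
    qed
    have nG: "norm (G s) = exp (Re s * T) * norm (m s)" for s
      by (simp add: G_def norm_mult)
    have circ: "norm s \<ge> R - c" "norm s > 0" if "norm (s - of_real c) = R" for s :: complex
      using that norm_triangle_ineq4[of s "of_real c"] c R0 by auto
    \<comment> \<open>One estimate for both arcs: \<open>H\<close> will be the modulus of the
      difference on the right arc and of the truncated transform on the left arc.\<close>
    have arc: "H * norm (G s) / norm s \<le> 2 * B * exp (c * T) / (R * (R - c))"
      if "norm (s - of_real c) = R" "H * \<bar>Re s - c\<bar> \<le> B * exp ((c - Re s) * T)" for H :: real and s :: complex
    proof -
      have "H * norm (G s) = (H * \<bar>Re s - c\<bar>) * exp (Re s * T) * 2 / R"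
        unfolding nG m_def norm_newman_factor[OF R0(1) that(1)] by simp
      also have "\<dots> \<le> (B * exp ((c - Re s) * T)) * exp (Re s * T) * 2 / R"
        using that(2) R0 by (intro divide_right_mono mult_right_mono) auto
      also have "\<dots> = 2 * B * exp (c * T) / R"
        by (simp add: algebra_simps exp_diff)
      finally have "H * norm (G s) / norm s \<le> 2 * B * exp (c * T) / R / (R - c)"
        using circ[OF that(1)] R0 B0 by (intro frac_le) auto
      then show ?thesis by simp
    qed
    have br: "norm (contour_integral ?r (\<lambda>s. trunc_laplace x T s * G s / s - F s * G s / s))
       \<le> 2 * B * exp (c * T) / (R * (R - c)) * R * (pi / 2 - - (pi/2))"
      unfolding right_arc_def
    proof (rule contour_integral_bound_part_circlepath_strong[where k = "{}"])
      show "(\<lambda>s. trunc_laplace x T s * G s / s - F s * G s / s) contour_integrable_on part_circlepath (complex_of_real c) R (- (pi / 2)) (pi / 2)"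
        using contour_integrable_diff[OF i1(1) i2(1)] by (simp add: right_arc_def)
      fix s assume "s \<in> path_image (part_circlepath (complex_of_real c) R (- (pi / 2)) (pi / 2)) - {}"
      then have s: "norm (s - of_real c) = R" "Re s \<ge> c"
        using path_image_right_arc[OF R0(1), of s c] by (auto simp: right_arc_def)
      have "norm (trunc_laplace x T s - F s) * \<bar>Re s - c\<bar> \<le> B * exp ((c - Re s) * T)"
        using tail[of s] s(2) B0 by (cases "Re s = c") (auto simp: divide_simps norm_minus_commute)
      from arc[OF s(1) this]
      show "norm (trunc_laplace x T s * G s / s - F s * G s / s) \<le> 2 * B * exp (c * T) / (R * (R - c))"
        by (simp add: norm_mult norm_divide flip: left_diff_distrib diff_divide_distrib)
    qed (use B0 R0 in auto)
    have bl: "norm (contour_integral ?l (\<lambda>s. trunc_laplace x T s * G s / s))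
       \<le> 2 * B * exp (c * T) / (R * (R - c)) * R * (3 * pi / 2 - pi/2)"
      unfolding left_arc_def
    proof (rule contour_integral_bound_part_circlepath_strong[where k = "{?a, ?a'}"])
      show "(\<lambda>s. trunc_laplace x T s * G s / s) contour_integrable_on part_circlepath (complex_of_real c) R (pi / 2) (3 * pi / 2)"
        using i1(2) by (simp add: left_arc_def)
      fix s assume "s \<in> path_image (part_circlepath (complex_of_real c) R (pi / 2) (3 * pi / 2)) - {?a, ?a'}"
      then have s: "norm (s - of_real c) = R" "Re s \<le> c" "s \<noteq> ?a" "s \<noteq> ?a'"
        using path_image_left_arc[OF R0(1), of s c] by (auto simp: left_arc_def)
      \<comment> \<open>The strict inequality demanded by \<open>head\<close> fails only at the two
        endpoints of the arc, which the integral bound allows to be left out.\<close>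
      have "Re s \<noteq> c"
      proof
        assume "Re s = c"
        then have "\<bar>Im s\<bar> = R" using s(1) by (simp add: cmod_def)
        then show False using s(3,4) \<open>Re s = c\<close> by (auto simp: complex_eq_iff abs_if split: if_splits)
      qed
      then have "norm (trunc_laplace x T s) * \<bar>Re s - c\<bar> \<le> B * exp ((c - Re s) * T)"
        using head[of s] s(2) by (auto simp: divide_simps)
      from arc[OF s(1) this]
      show "norm (trunc_laplace x T s * G s / s) \<le> 2 * B * exp (c * T) / (R * (R - c))"
        by (simp add: norm_mult norm_divide)
    qed (use B0 R0 in auto)
    have m3: "norm (m s) \<le> 3" if "- \<epsilon> \<le> Re s" "Re s \<le> c" "\<bar>Im s\<bar> \<le> R" for s
    proof -
      have "(c - Re s)\<^sup>2 \<le> R\<^sup>2" "(Im s)\<^sup>2 \<le> R\<^sup>2" using that R by (auto intro!: power2_mono simp: abs_le_iff)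
      then have "(norm (s - of_real c))\<^sup>2 / R\<^sup>2 \<le> 2"
        using R0 by (simp add: cmod_power2 divide_simps power2_commute)
      moreover have "norm (m s) \<le> 1 + (norm (s - of_real c))\<^sup>2 / R\<^sup>2"
        unfolding m_def using R0 by (intro norm_triangle_le) (simp add: norm_divide norm_power)
      ultimately show ?thesis by simp
    qed
    have hor: "norm (?F s) \<le> 3 * C * exp (c * T) / R" if "\<bar>Im s\<bar> = R" "- \<epsilon> \<le> Re s" "Re s \<le> c" for s
    proof -
      have "norm (F s) * (exp (Re s * T) * norm (m s)) / norm s \<le> C * (exp (c * T) * 3) / R"
        using Fle[of s] m3[of s] that T R0 C0 abs_Im_le_cmod[of s]
        by (intro frac_le mult_mono) (auto intro!: mult_right_mono)
      then show ?thesis by (simp add: norm_mult norm_divide nG mult_ac)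
    qed
    have b1: "norm (contour_integral (linepath ?a ?b) ?F) \<le> 3 * C * exp (c * T) / R * norm (?b - ?a)"
      by (rule contour_integral_bound_linepath[OF int(1)]) (use seg1 hor R0 C0 in auto)
    have b3: "norm (contour_integral (linepath ?b' ?a') ?F) \<le> 3 * C * exp (c * T) / R * norm (?a' - ?b')"
      by (rule contour_integral_bound_linepath[OF int(3)]) (use seg3 hor R0 C0 in auto)
    have n: "norm (?b - ?a) = c + \<epsilon>" "norm (?a' - ?b') = c + \<epsilon>"
      using c \<epsilon> by (auto simp: cmod_def)
    \<comment> \<open>The decay \<open>norm (F s) \<le> C / norm s\<close> and the denominator
      \<open>s\<close> of the integrand together give a bound
      \<open>K / (\<epsilon>\<^sup>2 + y\<^sup>2)\<close>, whose integral is at most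
      \<open>K * pi / \<epsilon>\<close> for every \<open>R\<close>.\<close>
    have b2: "norm (contour_integral (linepath ?b ?b') ?F) \<le> 3 * pi * C * exp (- \<epsilon> * T) / \<epsilon>"
    proof -
      define I where "I = contour_integral (linepath ?b ?b') ?F"
      have "(?F has_contour_integral I) (linepath ?b ?b')"
        unfolding I_def by (rule has_contour_integral_integral[OF int(2)])
      \<comment> \<open>The segment runs downwards; it is reversed so that the integral can be
        parametrised by an increasing imaginary part.\<close>
      then have "(?F has_contour_integral (- I)) (linepath ?b' ?b)"
        using has_contour_integral_reversepath[of "linepath ?b ?b'"] by simp
      then have I: "((\<lambda>y. ?F (Complex (- \<epsilon>) y)) has_integral (\<i> * I)) {- R..R}"
        using R0 by (subst (asm) has_contour_integral_linepath_same_Re_iff[where c = "- \<epsilon>" and a = "- R" and b = R]) auto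
      define K where "K = 3 * C * exp (- \<epsilon> * T)"
      have K0: "K \<ge> 0" using C0 by (simp add: K_def)
      have J: "((\<lambda>y. K / (\<epsilon>\<^sup>2 + y\<^sup>2)) has_integral (K / \<epsilon> * arctan (R / \<epsilon>) - K / \<epsilon> * arctan (- R / \<epsilon>))) {- R..R}"
      proof (rule fundamental_theorem_of_calculus)
        fix y assume "y \<in> {- R..R}"
        have "((\<lambda>y. K / \<epsilon> * arctan (y / \<epsilon>)) has_real_derivative K / \<epsilon> * (1 / \<epsilon> * inverse (1 + (y / \<epsilon>)\<^sup>2)))
            (at y within {- R..R})"
          using \<epsilon> by (auto intro!: derivative_eq_intros simp: divide_inverse)
        moreover have "1 + (y / \<epsilon>)\<^sup>2 = (\<epsilon>\<^sup>2 + y\<^sup>2) / \<epsilon>\<^sup>2"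
          using \<epsilon> by (simp add: power_divide add_divide_distrib)
        then have "K / \<epsilon> * (1 / \<epsilon> * inverse (1 + (y / \<epsilon>)\<^sup>2)) = K / (\<epsilon>\<^sup>2 + y\<^sup>2)"
          using \<epsilon> by (simp add: power2_eq_square)
        ultimately show "((\<lambda>y. K / \<epsilon> * arctan (y / \<epsilon>)) has_vector_derivative K / (\<epsilon>\<^sup>2 + y\<^sup>2)) (at y within {- R..R})"
          by (simp only: has_real_derivative_iff_has_vector_derivative)
      qed (use R0 in auto)
      have "norm (integral {- R..R} (\<lambda>y. ?F (Complex (- \<epsilon>) y))) \<le> integral {- R..R} (\<lambda>y. K / (\<epsilon>\<^sup>2 + y\<^sup>2))"
      proof (rule integral_norm_bound_integral[OF has_integral_integrable[OF I] has_integral_integrable[OF J]])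
        fix y assume y: "y \<in> {- R..R}"
        define s where "s = Complex (- \<epsilon>) y"
        have s: "Re s = - \<epsilon>" "Im s = y" by (auto simp: s_def)
        have ns: "norm s > 0" using s \<epsilon> by auto
        have "norm (F s) * norm s \<le> norm (F s) * (1 + norm s)" by (intro mult_left_mono) auto
        also have "\<dots> \<le> C" using C s by simp
        finally have "norm (F s) * norm s \<le> C" .
        then have "(norm (F s) * norm s) * (exp (- \<epsilon> * T) * norm (m s)) / (norm s)\<^sup>2 \<le> C * (exp (- \<epsilon> * T) * 3) / (norm s)\<^sup>2"
          using m3[of s] s y c \<epsilon> C0 by (intro divide_right_mono mult_mono) auto
        then have "norm (?F s) \<le> K / (norm s)\<^sup>2"
          using ns by (simp add: norm_mult norm_divide nG s K_def power2_eq_square mult_ac)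
        then show "norm (?F (Complex (- \<epsilon>) y)) \<le> K / (\<epsilon>\<^sup>2 + y\<^sup>2)"
          by (simp add: s_def cmod_power2)
      qed
      then have "norm I \<le> K / \<epsilon> * arctan (R / \<epsilon>) - K / \<epsilon> * arctan (- R / \<epsilon>)"
        using integral_unique[OF I] integral_unique[OF J] by (simp add: norm_mult)
      also have "\<dots> = K / \<epsilon> * (2 * arctan (R / \<epsilon>))" by (simp add: arctan_minus)
      also have "\<dots> \<le> K / \<epsilon> * pi"
        using arctan_ubound[of "R / \<epsilon>"] K0 \<epsilon> by (intro mult_left_mono) auto
      finally show ?thesis unfolding I_def K_def by (simp add: mult_ac)
    qed
    have "2 * B * exp (c * T) / (R * (R - c)) * R * pi = 2 * pi * B * exp (c * T) / (R - c)"
      using R0 by (simp add: field_simps)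
    then have br': "norm (contour_integral ?r (\<lambda>s. trunc_laplace x T s * G s / s - F s * G s / s)) \<le> 2 * pi * B * exp (c * T) / (R - c)"
      and bl': "norm (contour_integral ?l (\<lambda>s. trunc_laplace x T s * G s / s)) \<le> 2 * pi * B * exp (c * T) / (R - c)"
      using br bl by simp_all
    have tri: "norm (u + v - (w + (y + z))) \<le> norm u + norm v + (norm w + (norm y + norm z))" for u v w y z :: complex
      by (intro order_trans[OF norm_triangle_ineq4] add_mono order_trans[OF norm_triangle_ineq] order_refl)
    have add: "a + l + (h + (v + h')) \<le> P + Q + k" if "P = p + p" "Q = q + q" "a \<le> p" "l \<le> p" "h \<le> q" "h' \<le> q" "v \<le> k"
      for a l h v h' P Q p q k :: real
      using that by linarith
    have PQ: "4 * pi * B * exp (c * T) / (R - c) = 2 * pi * B * exp (c * T) / (R - c) + 2 * pi * B * exp (c * T) / (R - c)"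
      "6 * C * exp (c * T) * (c + \<epsilon>) / R = 3 * C * exp (c * T) / R * (c + \<epsilon>) + 3 * C * exp (c * T) / R * (c + \<epsilon>)"
      by simp_all
    have "norm (2 * pi * \<i> * ((trunc_laplace x T 0 - F 0) * G 0)) \<le> E R"
      unfolding eq E_def by (rule order_trans[OF tri add[OF PQ br' bl' b1[unfolded n] b3[unfolded n] b2]])
    moreover have "norm (G 0) \<ge> 1"
    proof -
      have "G 0 = of_real (1 + c\<^sup>2 / R\<^sup>2)" by (simp add: G_def m_def)
      then have "norm (G 0) = \<bar>1 + c\<^sup>2 / R\<^sup>2\<bar>" by (simp only: norm_of_real)
      then show ?thesis by (simp add: add_nonneg_nonneg abs_of_nonneg)
    qed
    then have "norm (2 * pi * (trunc_laplace x T 0 - F 0)) * 1 \<le> norm (2 * pi * (trunc_laplace x T 0 - F 0)) * norm (G 0)"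
      by (intro mult_left_mono) auto
    moreover have "norm (2 * pi * \<i> * ((trunc_laplace x T 0 - F 0) * G 0)) = norm (2 * pi * (trunc_laplace x T 0 - F 0)) * norm (G 0)"
      by (simp only: norm_mult norm_ii mult_1_right mult.assoc)
    ultimately show ?thesis by linarith
  qed
  \<comment> \<open>The quantity bounded in \<open>main\<close> does not depend on \<open>R\<close>,
    so it is bounded by the limit of \<open>E\<close>.\<close>
  have "(E \<longlongrightarrow> 3 * pi * C * exp (- \<epsilon> * T) / \<epsilon>) at_top"
  proof -
    have "((\<lambda>R. K / (R - c)) \<longlongrightarrow> 0) at_top" "((\<lambda>R. K / R) \<longlongrightarrow> 0) at_top" for K c :: real
      by real_asymp+
    from tendsto_add[OF tendsto_add[OF this(1)[of "4 * pi * B * exp (c * T)" c]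
          this(2)[of "6 * C * exp (c * T) * (c + \<epsilon>)"]] tendsto_const[of "3 * pi * C * exp (- \<epsilon> * T) / \<epsilon>"]]
    show ?thesis unfolding E_def[abs_def] by (simp only: add_0)
  qed
  then have "norm (2 * pi * (trunc_laplace x T 0 - F 0)) \<le> 3 * pi * C * exp (- \<epsilon> * T) / \<epsilon>"
    by (rule tendsto_lowerbound) (use main in \<open>auto intro: eventually_mono[OF eventually_gt_at_top[of "c + \<epsilon>"]]\<close>)
  moreover have "norm (2 * pi * (trunc_laplace x T 0 - F 0)) = 2 * pi * norm (trunc_laplace x T 0 - F 0)"
    by (simp only: norm_mult norm_of_real) simp
  ultimately have "pi * (2 * norm (trunc_laplace x T 0 - F 0)) \<le> pi * (3 * C * exp (- \<epsilon> * T) / \<epsilon>)"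
    by (simp add: mult_ac)
  then have "2 * norm (trunc_laplace x T 0 - F 0) \<le> 3 * C * exp (- \<epsilon> * T) / \<epsilon>"
    by (rule mult_left_le_imp_le) simp
  then show ?thesis using \<epsilon> by (simp add: field_simps)
qed

lemma trunc_laplace_tendsto_at_0:
  assumes x: "continuous_on {0..} x" and B: "\<And>t. t \<ge> 0 \<Longrightarrow> \<bar>x t\<bar> \<le> B * exp (c * t)" and c: "c > 0"
    and \<epsilon>: "0 < \<epsilon>" "\<epsilon> < \<epsilon>'" and F: "F holomorphic_on {s. Re s > - \<epsilon>'}"
    and C: "\<And>s. Re s \<ge> - \<epsilon> \<Longrightarrow> norm (F s) * (1 + norm s) \<le> C"
    and lim: "\<And>s. Re s > c \<Longrightarrow> ((\<lambda>T. trunc_laplace x T s) \<longlongrightarrow> F s) at_top"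
  shows "((\<lambda>T. trunc_laplace x T 0) \<longlongrightarrow> F 0) at_top"
proof (rule Lim_transform[OF tendsto_const])
  show "((\<lambda>T. trunc_laplace x T 0 - F 0) \<longlongrightarrow> 0) at_top"
  proof (rule Lim_null_comparison)
    show "\<forall>\<^sub>F T in at_top. norm (trunc_laplace x T 0 - F 0) \<le> 3 * C / (2 * \<epsilon>) * exp (- \<epsilon> * T)"
      using eventually_ge_at_top[of 0]
      by eventually_elim (rule trunc_laplace_error_bound[OF assms])
    have "((\<lambda>T. exp (- \<epsilon> * T)) \<longlongrightarrow> 0) at_top"
      using \<epsilon> by real_asymp
    then show "((\<lambda>T. 3 * C / (2 * \<epsilon>) * exp (- \<epsilon> * T)) \<longlongrightarrow> 0) at_top"
      by (rule tendsto_mult_right_zero)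
  qed
qed

section \<open>Linear systems with discrete delays\<close>

lemma delayed_integrable:
  fixes f :: "real \<Rightarrow> 'a::banach"
  assumes "continuous_on {0..} f" "\<And>t. t < 0 \<Longrightarrow> f t = 0"
  shows "(\<lambda>t. f (t - d)) integrable_on {a..b}"
proof -
  have "(\<lambda>t. f (t - d)) = (\<lambda>t. if t \<in> {d..} then f (t - d) else 0)"
    using assms(2) by auto
  moreover have "(\<lambda>t. f (t - d)) integrable_on {max d a..b}"
    by (intro integrable_continuous_real continuous_on_compose2[OF assms(1)] continuous_intros) auto
  moreover have "{d..} \<inter> {a..b} = {max d a..b}" by auto
  ultimately show ?thesis by (metis integrable_restrict_Int)
qed

text \<open>This is the substitution \<open>t - d\<close>. For \<open>T < d\<close> the interval
  \<open>{0..T - d}\<close> is empty, in agreement with the signal not having arrived yet.\<close>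

lemma delayed_integral:
  fixes f :: "real \<Rightarrow> 'a::banach"
  assumes "\<And>t. t < 0 \<Longrightarrow> f t = 0" "d \<ge> 0"
  shows "integral {0..T} (\<lambda>t. f (t - d)) = integral {0..T - d} f"
proof -
  have "(\<lambda>t. f (t - d)) = (\<lambda>t. if t \<in> {d..} then f (t - d) else 0)"
    using assms(1) by auto
  then have "integral {0..T} (\<lambda>t. f (t - d)) = integral ({d..} \<inter> {0..T}) (\<lambda>t. f (t - d))"
    by (metis Henstock_Kurzweil_Integration.integral_restrict_Int)
  also have "{d..} \<inter> {0..T} = {d..T}" using assms(2) by auto
  also have "integral {d..T} (\<lambda>t. f (t - d)) = integral {0..T - d} f"
    using integral_shift_real_ivl[of 0 "- d" "T - d" f] by simp
  finally show ?thesis .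
qed

text \<open>The only possible jump is at \<open>t = d\<close>, where the zero history switches to
  the initial value.\<close>

lemma delayed_isCont:
  fixes f :: "real \<Rightarrow> 'a::topological_monoid_add"
  assumes "continuous_on {0..} f" "\<And>t. t < 0 \<Longrightarrow> f t = 0" "t \<noteq> d"
  shows "isCont (\<lambda>t. f (t - d)) t"
proof (cases "t < d")
  case True
  have "continuous_on {..<d} (\<lambda>t. f (t - d))"
    using assms(2) by (subst continuous_on_cong[OF refl, of _ _ "\<lambda>_. 0"]) auto
  then show ?thesis using True by (simp add: continuous_on_eq_continuous_at)
next
  case False
  have "continuous_on {d<..} (\<lambda>t. f (t - d))"
    by (intro continuous_on_compose2[OF assms(1)] continuous_intros) auto
  then show ?thesis using False assms(3) by (simp add: continuous_on_eq_continuous_at)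
qed

lemma has_integral_exp_mult:
  fixes l S :: real
  assumes "l > 0" "0 \<le> t"
  shows "((\<lambda>u. S * exp (l * u)) has_integral (S * exp (l * t) - S) / l) {0..t}"
proof -
  have "((\<lambda>u. S * exp (l * u)) has_integral (S * exp (l * t) / l - S * exp (l * 0) / l)) {0..t}"
    using assms by (intro fundamental_theorem_of_calculus)
      (auto intro!: derivative_eq_intros simp flip: has_real_derivative_iff_has_vector_derivative)
  then show ?thesis by (simp add: diff_divide_distrib)
qed

text \<open>In the row \<open>p\<close> of a component of largest modulus \<open>M\<close>, the
  equation gives \<open>norm s * M \<le> \<beta> + K * M\<close>. The lemma controls convergence of
  the transforms, their decay for large \<open>s\<close>, and the location of the characteristic
  roots.\<close>

lemma diagonally_dominant_bound:
  fixes v b :: "nat \<Rightarrow> complex"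
  assumes eq: "\<And>i. i < N \<Longrightarrow> s * v i + (\<Sum>j<N. W i j * v j) = b i"
    and W: "\<And>i. i < N \<Longrightarrow> (\<Sum>j<N. norm (W i j)) \<le> K" and b: "\<And>i. i < N \<Longrightarrow> norm (b i) \<le> \<beta>"
    and K: "K < norm s" and i: "i < N"
  shows "norm (v i) \<le> \<beta> / (norm s - K)"
proof -
  define M where "M = Max ((\<lambda>i. norm (v i)) ` {..<N})"
  have M: "norm (v i) \<le> M" if "i < N" for i using that by (auto simp: M_def)
  have "M \<in> (\<lambda>i. norm (v i)) ` {..<N}" unfolding M_def using i by (intro Max_in) auto
  then obtain p where p: "p < N" "norm (v p) = M" by auto
  have "norm s * M = norm (b p - (\<Sum>j<N. W p j * v j))"
    using eq[OF p(1)] p(2) by (metis add_diff_cancel_right' norm_mult)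
  also have "\<dots> \<le> norm (b p) + norm (\<Sum>j<N. W p j * v j)" by (rule norm_triangle_ineq4)
  also have "norm (\<Sum>j<N. W p j * v j) \<le> (\<Sum>j<N. norm (W p j) * M)"
    by (rule order_trans[OF norm_sum]) (auto intro!: sum_mono mult_left_mono M simp: norm_mult)
  also have "\<dots> = (\<Sum>j<N. norm (W p j)) * M" by (simp add: sum_distrib_right)
  also have "\<dots> \<le> K * M" by (intro mult_right_mono W p) (use p in auto)
  finally have "(norm s - K) * M \<le> \<beta>" using b[OF p(1)] by (simp add: algebra_simps)
  then have "M \<le> \<beta> / (norm s - K)" using K by (simp add: pos_le_divide_eq mult.commute)
  then show ?thesis using M[OF i] by linarith
qed

section \<open>Retarded linear systems with zero history\<close>

locale delay_system =
  fixes N m :: nat and L :: "nat \<Rightarrow> nat \<Rightarrow> nat \<Rightarrow> real" and d :: "nat \<Rightarrow> real"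
  assumes N_pos: "N > 0" and d_nonneg: "\<And>k. k < m \<Longrightarrow> d k \<ge> 0"
begin

definition rhs :: "(nat \<Rightarrow> real \<Rightarrow> real) \<Rightarrow> nat \<Rightarrow> real \<Rightarrow> real" where
  "rhs x i t = - (\<Sum>k<m. \<Sum>j<N. L k i j * x j (t - d k))"

definition solution :: "(nat \<Rightarrow> real) \<Rightarrow> (nat \<Rightarrow> real \<Rightarrow> real) \<Rightarrow> bool" where
  "solution x0 x \<longleftrightarrow> (\<forall>i<N. (\<forall>t<0. x i t = 0) \<and> (\<forall>t\<ge>0. (rhs x i has_integral (x i t - x0 i)) {0..t}))"

definition coef :: "complex \<Rightarrow> nat \<Rightarrow> nat \<Rightarrow> complex" where
  "coef s i j = (\<Sum>k<m. of_real (L k i j) * exp (- (of_real (d k) * s)))"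

definition char_entry :: "complex \<Rightarrow> nat \<Rightarrow> nat \<Rightarrow> complex" where
  "char_entry s i j = (if i = j then s else 0) + coef s i j"

text \<open>The weights \<open>exp (d k)\<close> dominate \<open>norm (exp (- d k * s))\<close> for
  \<open>Re s \<ge> - 1\<close>, so \<open>K\<close> bounds the row sums of \<open>coef\<close> a
  little beyond the imaginary axis. The summand 1 makes \<open>K\<close> positive.\<close>

definition K :: real where
  "K = 1 + (\<Sum>i<N. \<Sum>k<m. \<Sum>j<N. \<bar>L k i j\<bar> * exp (d k))"

lemma K_ge: "i < N \<Longrightarrow> (\<Sum>k<m. \<Sum>j<N. \<bar>L k i j\<bar> * exp (d k)) \<le> K"
  unfolding K_def
  by (rule add_increasing) (auto intro!: member_le_sum[of i "{..<N}" "\<lambda>i. \<Sum>k<m. \<Sum>j<N. \<bar>L k i j\<bar> * exp (d k)"] sum_nonneg)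

lemma L_le_K: "i < N \<Longrightarrow> (\<Sum>k<m. \<Sum>j<N. \<bar>L k i j\<bar>) \<le> K"
  using d_nonneg
  by (intro order_trans[OF _ K_ge] sum_mono) (auto simp: mult_le_cancel_left1 zero_less_abs_iff)

lemma K_pos: "K > 0"
  unfolding K_def by (rule add_pos_nonneg) (auto intro!: sum_nonneg)

text \<open>Delays only look back, and the majorant \<open>S * exp (l * v)\<close> is nondecreasing
  in \<open>v\<close>, so each delayed value obeys the bound at time \<open>t\<close>.\<close>

lemma rhs_bound:
  assumes "i < N" "S \<ge> 0" "l \<ge> 0" and x: "\<And>j v. j < N \<Longrightarrow> v \<le> t \<Longrightarrow> \<bar>x j v\<bar> \<le> S * exp (l * v)"
  shows "\<bar>rhs x i t\<bar> \<le> K * S * exp (l * t)"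
proof -
  have le: "\<bar>x j (t - d k)\<bar> \<le> S * exp (l * t)" if j: "j < N" "k < m" for j k
  proof -
    have "\<bar>x j (t - d k)\<bar> \<le> S * exp (l * (t - d k))"
      using d_nonneg[OF j(2)] by (intro x j) auto
    also have "\<dots> \<le> S * exp (l * t)"
      using assms d_nonneg[OF j(2)] by (intro mult_left_mono) (auto intro!: mult_left_mono)
    finally show ?thesis .
  qed
  have "\<bar>rhs x i t\<bar> \<le> (\<Sum>k<m. \<Sum>j<N. \<bar>L k i j\<bar> * (S * exp (l * t)))"
    unfolding rhs_def abs_minus_cancel
    by (intro order_trans[OF sum_abs] sum_mono) (simp add: abs_mult le mult_left_mono)
  also have "\<dots> = (\<Sum>k<m. \<Sum>j<N. \<bar>L k i j\<bar>) * (S * exp (l * t))"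
    by (simp add: sum_distrib_right)
  also have "\<dots> \<le> K * (S * exp (l * t))"
    using assms by (intro mult_right_mono L_le_K) auto
  finally show ?thesis by (simp add: mult_ac)
qed

lemma sum_norm_coef:
  assumes "i < N" "Re s \<ge> - 1"
  shows "(\<Sum>j<N. norm (coef s i j)) \<le> K"
proof -
  have "norm (coef s i j) \<le> (\<Sum>k<m. \<bar>L k i j\<bar> * exp (d k))" for j
    unfolding coef_def
  proof (rule order_trans[OF norm_sum sum_mono])
    fix k assume "k \<in> {..<m}"
    then have "d k * (- Re s) \<le> d k * 1" using assms d_nonneg[of k] by (intro mult_left_mono) auto
    then show "norm (of_real (L k i j) * exp (- (of_real (d k) * s))) \<le> \<bar>L k i j\<bar> * exp (d k)"
      by (auto simp: norm_mult intro!: mult_left_mono)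
  qed
  then have "(\<Sum>j<N. norm (coef s i j)) \<le> (\<Sum>j<N. \<Sum>k<m. \<bar>L k i j\<bar> * exp (d k))"
    by (rule sum_mono)
  also have "\<dots> \<le> K" using K_ge[OF assms(1)] by (subst sum.swap)
  finally show ?thesis .
qed

lemma char_entry_sum:
  "i < N \<Longrightarrow> (\<Sum>j<N. char_entry s i j * v j) = s * v i + (\<Sum>j<N. coef s i j * v j)"
  by (simp add: char_entry_def distrib_right sum.distrib if_distrib[of "\<lambda>z. z * _"] cong: if_cong)

context
  fixes x0 x assumes sol: "solution x0 x"
begin

lemma sol_neg: "i < N \<Longrightarrow> t < 0 \<Longrightarrow> x i t = 0"
  using sol by (auto simp: solution_def)

lemma sol_integral:
  assumes "i < N" "t \<ge> 0"
  shows "rhs x i integrable_on {0..t}" "x i t = x0 i + integral {0..t} (rhs x i)"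
proof -
  have "(rhs x i has_integral (x i t - x0 i)) {0..t}" using sol assms by (auto simp: solution_def)
  then show "rhs x i integrable_on {0..t}" "x i t = x0 i + integral {0..t} (rhs x i)"
    by (auto simp: has_integral_iff)
qed

lemma sol_cont:
  assumes "i < N"
  shows "continuous_on {0..} (x i)"
proof -
  have "continuous (at t within {0..}) (x i)" if "t \<ge> 0" for t
  proof -
    have "continuous_on {0..t+1} (\<lambda>u. x0 i + integral {0..u} (rhs x i))"
      using that assms by (intro continuous_intros indefinite_integral_continuous_1 sol_integral) auto
    then have "continuous_on {0..t+1} (x i)"
      by (rule continuous_on_cong[THEN iffD1, rotated -1]) (use sol_integral(2)[OF assms] in auto)
    then have "continuous (at t within {0..t+1}) (x i)"
      using that by (auto simp: continuous_on_eq_continuous_within)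
    moreover have "at t within {0..t+1} = at t within {0..}"
      by (rule at_within_nhd[of _ "{..<t+1}"]) auto
    ultimately show ?thesis by simp
  qed
  then show ?thesis by (simp add: continuous_on_eq_continuous_within)
qed

text \<open>Let \<open>S\<close> be the largest value of
  \<open>exp (- 2 * K * u) * \<bar>x i u\<bar>\<close> over all components and \<open>u\<close> in
  \<open>{0..t}\<close>. Integrating \<open>K * S * exp (2 * K * u)\<close> yields a factor 1/2, so
  the integral equation at a maximiser gives \<open>S \<le> \<bar>x0 p\<bar> + S / 2\<close>, and
  \<open>S\<close> is at most twice the size of the initial value.\<close>

lemma sol_growth:
  assumes "i < N" "t \<ge> 0"
  shows "\<bar>x i t\<bar> \<le> 2 * (\<Sum>i<N. \<bar>x0 i\<bar>) * exp (2 * K * t)"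
proof -
  define \<phi> where "\<phi> i u = exp (- (2 * K * u)) * \<bar>x i u\<bar>" for i u
  have "\<exists>u\<in>{0..t}. \<forall>v\<in>{0..t}. \<phi> i v \<le> \<phi> i u" if "i < N" for i
    unfolding \<phi>_def using assms(2)
    by (intro continuous_attains_sup continuous_intros continuous_on_subset[OF sol_cont[OF that]]) auto
  then have "\<forall>i\<in>{..<N}. \<exists>u. u \<in> {0..t} \<and> (\<forall>v\<in>{0..t}. \<phi> i v \<le> \<phi> i u)" by blast
  from bchoice[OF this] obtain u where "\<forall>i\<in>{..<N}. u i \<in> {0..t} \<and> (\<forall>v\<in>{0..t}. \<phi> i v \<le> \<phi> i (u i))" ..
  then have u: "u i \<in> {0..t}" "v \<in> {0..t} \<Longrightarrow> \<phi> i v \<le> \<phi> i (u i)" if "i < N" for i v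
    using that by auto
  define S where "S = Max ((\<lambda>i. \<phi> i (u i)) ` {..<N})"
  have S: "\<phi> i v \<le> S" if "i < N" "v \<in> {0..t}" for i v
    by (rule order_trans[OF u(2)[OF that(1,2)]]) (use that in \<open>auto simp: S_def\<close>)
  have "S \<in> (\<lambda>i. \<phi> i (u i)) ` {..<N}" unfolding S_def using N_pos by (intro Max_in) auto
  then obtain p where p: "p < N" "\<phi> p (u p) = S" by auto
  have S0: "S \<ge> 0" using p(2) by (auto simp: \<phi>_def)
  let ?u = "u p"
  have up: "0 \<le> ?u" "?u \<le> t" using u(1)[OF p(1)] by auto
  have xS: "\<bar>x j v\<bar> \<le> S * exp (2 * K * v)" if "j < N" "v \<in> {0..t}" for j v
  proof -
    have "exp (2 * K * v) * (exp (- (2 * K * v)) * \<bar>x j v\<bar>) \<le> exp (2 * K * v) * S"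
      using S[OF that] unfolding \<phi>_def by (rule mult_left_mono) simp
    also have "exp (2 * K * v) * (exp (- (2 * K * v)) * \<bar>x j v\<bar>) = \<bar>x j v\<bar>"
      by (simp flip: mult.assoc exp_add)
    finally show ?thesis by (simp only: mult.commute)
  qed
  have r: "\<bar>rhs x p w\<bar> \<le> K * S * exp (2 * K * w)" if w: "w \<in> {0..?u}" for w
  proof (rule rhs_bound[OF p(1) S0])
    fix j v assume "j < N" "v \<le> w"
    then show "\<bar>x j v\<bar> \<le> S * exp (2 * K * v)"
      using xS[of j v] sol_neg[of j v] S0 w up by (cases "v < 0") auto
  qed (use K_pos in auto)
  have I: "((\<lambda>w. K * S * exp (2 * K * w)) has_integral (K * S * exp (2 * K * ?u) - K * S) / (2 * K)) {0..?u}"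
    using has_integral_exp_mult[of "2 * K" ?u "K * S"] K_pos up(1) by simp
  have "norm (integral {0..?u} (rhs x p)) \<le> integral {0..?u} (\<lambda>w. K * S * exp (2 * K * w))"
    by (rule integral_norm_bound_integral[OF sol_integral(1)[OF p(1) up(1)] has_integral_integrable[OF I]])
      (simp only: real_norm_def r)
  also have "\<dots> = (K * S * exp (2 * K * ?u) - K * S) / (2 * K)"
    by (rule integral_unique[OF I])
  also have "\<dots> \<le> S * exp (2 * K * ?u) / 2"
  proof -
    have "(K * S * exp (2 * K * ?u) - K * S) / (2 * K) = (S * exp (2 * K * ?u) - S) / 2"
      using K_pos by (simp add: divide_simps) (simp add: algebra_simps)
    then show ?thesis using S0 by simp
  qed
  finally have "\<bar>x p ?u\<bar> \<le> \<bar>x0 p\<bar> + S * exp (2 * K * ?u) / 2"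
    using sol_integral(2)[OF p(1) up(1)] by simp
  then have "exp (- (2 * K * ?u)) * \<bar>x p ?u\<bar> \<le> exp (- (2 * K * ?u)) * (\<bar>x0 p\<bar> + S * exp (2 * K * ?u) / 2)"
    by (rule mult_left_mono) simp
  also have "\<dots> = exp (- (2 * K * ?u)) * \<bar>x0 p\<bar> + S / 2"
    by (simp add: distrib_left mult.left_commute[of "exp (- (2 * K * ?u))"] flip: exp_add)
  also have "exp (- (2 * K * ?u)) * \<bar>x0 p\<bar> \<le> 1 * \<bar>x0 p\<bar>"
    using up K_pos by (intro mult_right_mono) auto
  also have "1 * \<bar>x0 p\<bar> \<le> (\<Sum>i<N. \<bar>x0 i\<bar>)"
    using p(1) member_le_sum[of p "{..<N}" "\<lambda>i. \<bar>x0 i\<bar>"] by auto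
  finally have "S \<le> 2 * (\<Sum>i<N. \<bar>x0 i\<bar>)" using p(2) by (simp add: \<phi>_def)
  then have "S * exp (2 * K * t) \<le> 2 * (\<Sum>i<N. \<bar>x0 i\<bar>) * exp (2 * K * t)"
    by (rule mult_right_mono) simp
  moreover have "\<bar>x i t\<bar> \<le> S * exp (2 * K * t)" by (rule xS) (use assms in auto)
  ultimately show ?thesis by (rule order_trans[rotated])
qed

text \<open>The function \<open>exp (- s * t) * x i t\<close> is differentiated and integrated back
  over \<open>{0..T}\<close>. Shifting the delayed terms produces the factors
  \<open>exp (- d k * s)\<close> and shortens their intervals to
  \<open>{0..T - d k}\<close>.\<close>

lemma sol_laplace:
  assumes i: "i < N" and T: "T \<ge> 0"
  shows "s * trunc_laplace (x i) T s = of_real (x0 i) - exp (- s * of_real T) * of_real (x i T)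
    - (\<Sum>k<m. \<Sum>j<N. of_real (L k i j) * exp (- (of_real (d k) * s)) * trunc_laplace (x j) (T - d k) s)"
proof -
  define z where "z t = exp (- s * of_real t) * complex_of_real (x i t)" for t
  define e where "e j t = exp (- s * of_real t) * complex_of_real (x j t)" for j t
  have e0: "e j t = 0" if "j < N" "t < 0" for j t using that sol_neg by (simp add: e_def)
  have ec: "continuous_on {0..} (e j)" if "j < N" for j
    unfolding e_def by (intro continuous_intros sol_cont that)
  have lap_e: "trunc_laplace (x j) T s = integral {0..T} (e j)" for j T by (simp add: trunc_laplace_def e_def[abs_def])
  define z' where "z' t = - s * e i t - (\<Sum>k<m. \<Sum>j<N. of_real (L k i j) * exp (- (of_real (d k) * s)) * e j (t - d k))" for t
  \<comment> \<open>The right-hand side can jump at the times \<open>d k\<close>, so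
    differentiability is claimed only off this finite set; continuity of \<open>z\<close> closes the
    gaps.\<close>
  have "(z' has_integral (z T - z 0)) {0..T}"
  proof (rule fundamental_theorem_of_calculus_interior_strong[of "d ` {..<m}"])
    show "continuous_on {0..T} z"
      unfolding z_def by (intro continuous_intros continuous_on_subset[OF sol_cont[OF i]]) auto
    fix t assume t: "t \<in> {0<..<T} - d ` {..<m}"
    have rc: "isCont (rhs x i) t"
      unfolding rhs_def[abs_def] using t
      by (intro continuous_intros delayed_isCont sol_cont sol_neg) auto
    have "((\<lambda>u. integral {0..u} (rhs x i)) has_vector_derivative rhs x i t) (at t within {0..T} - {})"
    proof (rule integral_has_vector_derivative_continuous_at)
      show "rhs x i integrable_on {0..T}" using i T by (rule sol_integral(1))
      show "t \<in> {0..T} - {}" using t by simp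
      show "continuous (at t within {0..T} - {}) (rhs x i)"
        using rc by (rule continuous_at_imp_continuous_at_within)
    qed simp
    moreover have "at t within {0..T} - {} = at t"
      unfolding Diff_empty by (rule at_within_interior) (use t in \<open>simp add: interior_atLeastAtMost_real\<close>)
    ultimately have "((\<lambda>u. x0 i + integral {0..u} (rhs x i)) has_vector_derivative 0 + rhs x i t) (at t)"
      by (intro has_vector_derivative_add has_vector_derivative_const) simp
    then have "((\<lambda>u. x0 i + integral {0..u} (rhs x i)) has_vector_derivative rhs x i t) (at t)" by simp
    then have "(x i has_vector_derivative rhs x i t) (at t)"
      by (rule has_vector_derivative_transform_within_open[of _ _ _ "{0<..}"])
        (use t sol_integral(2)[OF i] in auto)
    then have dx: "((\<lambda>u. complex_of_real (x i u)) has_vector_derivative of_real (rhs x i t)) (at t)"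
      by (rule bounded_linear.has_vector_derivative[OF bounded_linear_of_real])
    have de: "((\<lambda>u. exp (- s * of_real u)) has_vector_derivative - s * exp (- s * of_real t)) (at t)"
      by (rule has_vector_derivative_real_field) (auto intro!: derivative_eq_intros)
    have shift: "exp (- s * of_real t) * of_real (x j (t - d k)) = exp (- (of_real (d k) * s)) * e j (t - d k)" for j k
    proof -
      have "exp (- s * of_real t) = exp (- (of_real (d k) * s)) * exp (- s * of_real (t - d k))"
        by (subst exp_add[symmetric]) (simp add: algebra_simps)
      then show ?thesis by (simp only: e_def mult.assoc)
    qed
    have "exp (- s * of_real t) * of_real (rhs x i t)
        = - (\<Sum>k<m. \<Sum>j<N. of_real (L k i j) * (exp (- s * of_real t) * of_real (x j (t - d k))))"
      by (simp add: rhs_def sum_distrib_left mult.left_commute)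
    also have "\<dots> = - (\<Sum>k<m. \<Sum>j<N. of_real (L k i j) * exp (- (of_real (d k) * s)) * e j (t - d k))"
      by (simp only: shift mult.assoc)
    finally show "(z has_vector_derivative z' t) (at t)"
      using has_vector_derivative_mult[OF de dx] unfolding z_def z'_def by (simp add: e_def algebra_simps)
  qed (use T in auto)
  moreover have "(z' has_integral (- s * integral {0..T} (e i)
      - (\<Sum>k<m. \<Sum>j<N. of_real (L k i j) * exp (- (of_real (d k) * s)) * integral {0..T - d k} (e j)))) {0..T}"
    unfolding z'_def
  proof (intro has_integral_diff has_integral_sum has_integral_mult_right finite_lessThan)
    show "(e i has_integral integral {0..T} (e i)) {0..T}"
      using delayed_integrable[OF ec[OF i] e0[OF i], of 0] by (simp add: integrable_integral)
    fix k j assume "k \<in> {..<m}" "j \<in> {..<N}"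
    then show "((\<lambda>t. e j (t - d k)) has_integral integral {0..T - d k} (e j)) {0..T}"
      using delayed_integrable[OF ec e0, of j "d k" 0 T] delayed_integral[of "e j" "d k" T] e0 d_nonneg
      by (simp add: has_integral_iff)
  qed
  ultimately have "z T - z 0 = - s * integral {0..T} (e i)
      - (\<Sum>k<m. \<Sum>j<N. of_real (L k i j) * exp (- (of_real (d k) * s)) * integral {0..T - d k} (e j))"
    by (rule has_integral_unique)
  moreover have "z 0 = of_real (x0 i)" using sol_integral(2)[OF i, of 0] by (simp add: z_def)
  ultimately show ?thesis by (simp add: lap_e z_def algebra_simps)
qed

text \<open>All transforms are brought to the common endpoint \<open>T\<close>, which makes the
  characteristic matrix appear. The price is one correction over the window from
  \<open>T - d k\<close> to \<open>T\<close> for each delay.\<close>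

lemma sol_char:
  assumes i: "i < N" and T: "T \<ge> 0"
  shows "(\<Sum>j<N. char_entry s i j * trunc_laplace (x j) T s)
    = of_real (x0 i) - exp (- s * of_real T) * of_real (x i T)
    + (\<Sum>k<m. \<Sum>j<N. of_real (L k i j) * exp (- (of_real (d k) * s)) * (trunc_laplace (x j) T s - trunc_laplace (x j) (T - d k) s))"
proof -
  have "(\<Sum>j<N. coef s i j * trunc_laplace (x j) T s)
      = (\<Sum>k<m. \<Sum>j<N. of_real (L k i j) * exp (- (of_real (d k) * s)) * trunc_laplace (x j) T s)"
    unfolding coef_def sum_distrib_right by (rule sum.swap)
  then show ?thesis
    unfolding char_entry_sum[OF i] sol_laplace[OF i T]
    by (simp add: right_diff_distrib sum_subtractf)
qed

end

end

section \<open>Persistent modes, existence of solutions, and left null vectors\<close>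

text \<open>Shifting \<open>T\<close> by \<open>h\<close> multiplies the limit by
  \<open>exp (s * h)\<close>, so the limit is 0 as soon as some \<open>exp (s * h)\<close> differs
  from 1. Since \<open>Re s \<ge> 0\<close> keeps the modulus at least \<open>norm \<alpha>\<close>
  for \<open>T \<ge> 0\<close>, also \<open>\<alpha>\<close> is 0.\<close>

lemma exp_tendsto_imp_zero:
  fixes s \<alpha> \<beta> :: complex
  assumes lim: "((\<lambda>T. exp (s * of_real T) * \<alpha>) \<longlongrightarrow> \<beta>) at_top" and s: "Re s \<ge> 0" "s \<noteq> 0"
  shows "\<alpha> = 0"
proof -
  have shift: "exp (s * of_real h) * \<beta> = \<beta>" for h :: real
  proof (rule tendsto_unique[OF _ _ lim])
    show "((\<lambda>T. exp (s * of_real T) * \<alpha>) \<longlongrightarrow> exp (s * of_real h) * \<beta>) at_top"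
    proof (rule Lim_transform_eventually)
      have "filterlim (\<lambda>T. T - h) at_top at_top" by real_asymp
      from filterlim_compose[OF lim this]
      show "((\<lambda>T. exp (s * of_real h) * (exp (s * of_real (T - h)) * \<alpha>)) \<longlongrightarrow> exp (s * of_real h) * \<beta>) at_top"
        by (intro tendsto_mult tendsto_const)
      show "\<forall>\<^sub>F T in at_top. exp (s * of_real h) * (exp (s * of_real (T - h)) * \<alpha>) = exp (s * of_real T) * \<alpha>"
        unfolding mult.assoc[symmetric] exp_add[symmetric] by (simp add: algebra_simps)
    qed
  qed simp
  \<comment> \<open>On the imaginary axis half a period turns the exponential into -1; off the axis
    already \<open>h = 1\<close> changes the modulus.\<close>
  have "\<exists>h. exp (s * of_real h) \<noteq> 1"
  proof (cases "Re s = 0")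
    case True
    then have "s * of_real (pi / Im s) = \<i> * of_real pi"
      using s by (auto simp: complex_eq_iff)
    then have "exp (s * of_real (pi / Im s)) = - 1" by (simp add: exp_pi_i)
    then show ?thesis by (metis one_neq_neg_one)
  next
    case False
    then have "norm (exp (s * of_real 1)) \<noteq> 1" by simp
    then show ?thesis by (metis norm_one)
  qed
  then have "\<beta> = 0" using shift by (metis mult_cancel_right1)
  then have "((\<lambda>T. norm (exp (s * of_real T) * \<alpha>)) \<longlongrightarrow> 0) at_top"
    using tendsto_norm[OF lim] by simp
  moreover have "\<forall>\<^sub>F T in at_top. norm \<alpha> \<le> norm (exp (s * of_real T) * \<alpha>)"
    using eventually_ge_at_top[of 0]
    by eventually_elim (use s in \<open>auto simp: norm_mult mult_le_cancel_right1 intro: mult_nonneg_nonneg\<close>)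
  ultimately have "norm \<alpha> \<le> 0" by (intro tendsto_lowerbound) auto
  then show ?thesis by simp
qed

text \<open>On the window \<open>exp (- s * t)\<close> has modulus at most
  \<open>exp (- Re s * (T - d))\<close>, which the factor in front cancels. What remains is the
  supremum of \<open>y\<close> over a window of fixed length \<open>d\<close>.\<close>

lemma trunc_laplace_window_tendsto_0:
  assumes y: "continuous_on {0..} y" "(y \<longlongrightarrow> 0) at_top" and s: "Re s \<ge> 0" and d: "d \<ge> 0"
  shows "((\<lambda>T. exp (s * of_real (T - d)) * (trunc_laplace y T s - trunc_laplace y (T - d) s)) \<longlongrightarrow> 0) at_top"
proof (rule tendstoI)
  fix e :: real assume e: "e > 0"
  \<comment> \<open>Dividing by \<open>d + 1\<close> instead of \<open>d\<close> also covers
    \<open>d = 0\<close>.\<close>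
  define e' where "e' = e / (d + 1)"
  have e': "e' > 0" "e' * d < e" using e d by (auto simp: e'_def field_simps)
  have "\<forall>\<^sub>F t in at_top. norm (y t) < e'" using tendstoD[OF y(2) e'(1)] by simp
  then obtain U where U: "\<And>t. t \<ge> U \<Longrightarrow> \<bar>y t\<bar> < e'" by (auto simp: eventually_at_top_linorder)
  show "\<forall>\<^sub>F T in at_top. dist (exp (s * of_real (T - d)) * (trunc_laplace y T s - trunc_laplace y (T - d) s)) 0 < e"
    using eventually_ge_at_top[of "max 0 U + d"]
  proof eventually_elim
    case (elim T)
    let ?f = "\<lambda>t. exp (- s * of_real t) * of_real (y t) :: complex"
    have T: "0 \<le> T - d" "T - d \<le> T" "U \<le> T - d" using elim d by auto
    have i: "(?f has_integral integral {T - d..T} ?f) {T - d..T}"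
      by (intro integrable_integral trunc_laplace_integrable y T)
    have "trunc_laplace y T s = trunc_laplace y (T - d) s + integral {T - d..T} ?f"
      unfolding trunc_laplace_def
      by (rule Henstock_Kurzweil_Integration.integral_combine[symmetric])
        (use T trunc_laplace_integrable[OF y(1)] in auto)
    moreover have "norm (integral {T - d..T} ?f) \<le> exp (- (Re s * (T - d))) * e' * measure lborel {T - d..T}"
    proof (rule has_integral_bound_real[where S = "{}", OF _ _ i])
      fix t assume t: "t \<in> {T - d..T} - {}"
      have "Re s * (T - d) \<le> Re s * t" using t s by (intro mult_left_mono) auto
      then show "norm (?f t) \<le> exp (- (Re s * (T - d))) * e'"
        using U[of t] T t by (auto simp: norm_mult intro!: mult_mono)
    qed (use e' in auto)
    ultimately have "norm (exp (s * of_real (T - d)) * (trunc_laplace y T s - trunc_laplace y (T - d) s))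
        \<le> exp (Re s * (T - d)) * (exp (- (Re s * (T - d))) * e' * d)"
      using d by (simp add: norm_mult)
    also have "\<dots> = e' * d" by (simp flip: exp_add mult.assoc)
    finally show ?case using e' by simp
  qed
qed

context delay_system
begin

lemma rhs_integrable:
  assumes "\<And>j. j < N \<Longrightarrow> continuous_on {0..} (x j)" "\<And>j t. j < N \<Longrightarrow> t < 0 \<Longrightarrow> x j t = 0"
  shows "rhs x i integrable_on {a..b}"
  unfolding rhs_def[abs_def]
  by (intro integrable_neg integrable_sum integrable_on_mult_right delayed_integrable assms) auto

text \<open>Banach's fixed point theorem for the integral equation, in the weighted unknown
  \<open>y (i, t) = exp (- 2 K t) * x i t\<close>; making the index part of the argument, with its discrete metric,
  lets the type of bounded continuous functions serve as the complete space.\<close>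
lemma solution_exists: "\<exists>x. solution x0 x"
proof -
  define l where "l = 2 * K"
  have l: "l > 0" using K_pos by (simp add: l_def)
  \<comment> \<open>This undoes the exponential weight and restores the zero history.\<close>
  define e where "e y j t = (if t \<ge> 0 then exp (l * t) * apply_bcontfun y (discrete j, t) else 0)"
    for y :: "(nat discrete \<times> real) \<Rightarrow>\<^sub>C real" and j :: nat and t
  have e_cont: "continuous_on {0..} (e y j)" for y j
  proof -
    have "continuous_on {0..} (\<lambda>t. exp (l * t) * apply_bcontfun y (discrete j, t))"
      by (intro continuous_intros continuous_on_compose2[OF continuous_on_apply_bcontfun[of UNIV]]) auto
    then show ?thesis by (rule continuous_on_cong[THEN iffD1, rotated -1]) (auto simp: e_def)
  qed
  have e_int: "rhs (e y) i integrable_on {a..b}" for y i a b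
    by (rule rhs_integrable[OF e_cont]) (auto simp: e_def)
  define G where "G y i t = x0 i + integral {0..t} (rhs (e y) i)" for y i t
  have G_cont: "continuous_on {0..} (G y i)" for y i
  proof -
    have "continuous (at t within {0..}) (G y i)" if "t \<ge> 0" for t
    proof -
      have "continuous_on {0..t+1} (G y i)"
        unfolding G_def by (intro continuous_intros indefinite_integral_continuous_1 e_int)
      then have "continuous (at t within {0..t+1}) (G y i)"
        using that by (auto simp: continuous_on_eq_continuous_within)
      moreover have "at t within {0..t+1} = at t within {0..}"
        by (rule at_within_nhd[of _ "{..<t+1}"]) auto
      ultimately show ?thesis by simp
    qed
    then show ?thesis by (simp add: continuous_on_eq_continuous_within)
  qed
  \<comment> \<open>The weight has rate \<open>l = 2 * K\<close>, so integration gains exactly the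
    factor 1/2 that becomes the contraction constant.\<close>
  have int_le: "norm (integral {0..t} f) \<le> S * exp (l * t) / 2"
    if "f integrable_on {0..t}" "t \<ge> 0" "S \<ge> 0" "\<And>u. 0 \<le> u \<Longrightarrow> \<bar>f u\<bar> \<le> K * S * exp (l * u)" for f t S
  proof -
    note I = has_integral_exp_mult[OF l that(2), of "K * S"]
    have "norm (integral {0..t} f) \<le> integral {0..t} (\<lambda>u. K * S * exp (l * u))"
      by (rule integral_norm_bound_integral[OF that(1) has_integral_integrable[OF I]]) (use that(4) in auto)
    also have "\<dots> = K * (S * exp (l * t) - S) / (K * 2)"
      unfolding integral_unique[OF I] by (simp add: l_def right_diff_distrib mult_ac)
    also have "\<dots> = (S * exp (l * t) - S) / 2"
      using K_pos by (intro mult_divide_mult_cancel_left) simp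
    finally show ?thesis using that(3) by simp
  qed
  have e_diff: "rhs (e y) i t - rhs (e z) i t = rhs (\<lambda>j t. e y j t - e z j t) i t" for y z i t
    by (simp add: rhs_def right_diff_distrib sum_subtractf)
  have G_diff: "exp (- (l * t)) * \<bar>G y i t - G z i t\<bar> \<le> dist y z / 2" if "i < N" "t \<ge> 0" for y z i t
  proof -
    have "norm (integral {0..t} (\<lambda>t. rhs (e y) i t - rhs (e z) i t)) \<le> dist y z * exp (l * t) / 2"
    proof (rule int_le)
      fix u :: real
      have "\<bar>e y j v - e z j v\<bar> \<le> dist y z * exp (l * v)" for j v
        using dist_bounded[of y "(discrete j, v)" z]
        by (auto simp: e_def dist_real_def abs_mult mult.commute simp flip: right_diff_distrib)
      then show "\<bar>rhs (e y) i u - rhs (e z) i u\<bar> \<le> K * dist y z * exp (l * u)"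
        unfolding e_diff using l that by (intro rhs_bound) auto
    qed (use that in \<open>auto intro!: integrable_diff e_int\<close>)
    then have "\<bar>G y i t - G z i t\<bar> \<le> dist y z * exp (l * t) / 2"
      by (simp add: G_def integral_diff[OF e_int e_int])
    then have "exp (- (l * t)) * \<bar>G y i t - G z i t\<bar> \<le> exp (- (l * t)) * (dist y z * exp (l * t) / 2)"
      by (rule mult_left_mono) simp
    also have "\<dots> = dist y z / 2" by (simp add: exp_minus)
    finally show ?thesis .
  qed
  \<comment> \<open>A bounded continuous function must be defined on the whole type: indices from
    \<open>N\<close> on get 0, and negative times get the value at time 0.\<close>
  define H where "H y p = (if of_discrete (fst p) < N then exp (- (l * max 0 (snd p))) * G y (of_discrete (fst p)) (max 0 (snd p)) else 0)" for y p
  have H_cont: "continuous_on UNIV (H y)" for y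
  proof -
    have "continuous_on ({i} \<times> UNIV) (H y)" for i
    proof (cases "of_discrete i < N")
      case True
      have "continuous_on ({i} \<times> UNIV) (\<lambda>p::nat discrete \<times> real. exp (- (l * max 0 (snd p))) * G y (of_discrete i) (max 0 (snd p)))"
        by (intro continuous_intros continuous_on_compose2[OF G_cont]) auto
      then show ?thesis
        by (rule continuous_on_cong[THEN iffD1, rotated -1]) (use True in \<open>auto simp: H_def\<close>)
    next
      case False
      then show ?thesis
        by (subst continuous_on_cong[OF refl, of _ _ "\<lambda>_. 0"]) (auto simp: H_def)
    qed
    then have "continuous_on (\<Union>i. {i} \<times> UNIV) (H y)"
      by (intro continuous_on_open_UN open_Times) (auto intro: Discrete_Topology.open_discrete)
    moreover have "(\<Union>i. {i} \<times> UNIV) = (UNIV :: (nat discrete \<times> real) set)" by auto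
    ultimately show ?thesis by simp
  qed
  \<comment> \<open>At the zero function the integral operator returns the initial value, so the
    contraction estimate against 0 shows that every \<open>H y\<close> is bounded.\<close>
  have G0: "G 0 i t = x0 i" for i t
  proof -
    have "e 0 j t = 0" for j t by (simp add: e_def zero_bcontfun.rep_eq)
    then have "rhs (e 0) i = (\<lambda>_. 0)" by (simp add: rhs_def fun_eq_iff)
    then show ?thesis by (simp add: G_def)
  qed
  have H_bound: "norm (H y p) \<le> dist y 0 / 2 + (\<Sum>i<N. \<bar>x0 i\<bar>)" for y p
  proof (cases "of_discrete (fst p) < N")
    case True
    define t where "t = max 0 (snd p)"
    have "t \<ge> 0" by (simp add: t_def)
    have "norm (H y p) = exp (- (l * t)) * \<bar>(G y (of_discrete (fst p)) t - G 0 (of_discrete (fst p)) t) + x0 (of_discrete (fst p))\<bar>"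
      using True by (simp add: H_def t_def abs_mult G0)
    also have "\<dots> \<le> exp (- (l * t)) * (\<bar>G y (of_discrete (fst p)) t - G 0 (of_discrete (fst p)) t\<bar> + \<bar>x0 (of_discrete (fst p))\<bar>)"
      by (intro mult_left_mono abs_triangle_ineq) auto
    also have "\<dots> \<le> dist y 0 / 2 + 1 * \<bar>x0 (of_discrete (fst p))\<bar>"
      unfolding distrib_left using \<open>t \<ge> 0\<close> l True by (intro add_mono G_diff mult_right_mono) auto
    also have "\<bar>x0 (of_discrete (fst p))\<bar> \<le> (\<Sum>i<N. \<bar>x0 i\<bar>)"
      using True member_le_sum[of "of_discrete (fst p)" "{..<N}" "\<lambda>i. \<bar>x0 i\<bar>"] by auto
    finally show ?thesis by simp
  qed (auto simp: H_def intro!: add_nonneg_nonneg sum_nonneg)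
  define \<Phi> where "\<Phi> y = Bcontfun (H y)" for y
  have \<Phi>: "apply_bcontfun (\<Phi> y) p = H y p" for y p
    unfolding \<Phi>_def by (subst Bcontfun_inverse[OF bcontfun_normI[OF H_cont H_bound]]) simp
  have "\<exists>!y. \<Phi> y = y"
  proof (rule banach_fix_type[of "1/2"])
    show "\<forall>y z. dist (\<Phi> y) (\<Phi> z) \<le> 1 / 2 * dist y z"
    proof (intro allI dist_bound)
      fix y z p
      show "dist (apply_bcontfun (\<Phi> y) p) (apply_bcontfun (\<Phi> z) p) \<le> 1 / 2 * dist y z"
        using G_diff[of "of_discrete (fst p)" "max 0 (snd p)" y z]
        by (auto simp: \<Phi> H_def dist_real_def abs_mult simp flip: right_diff_distrib)
    qed
  qed auto
  then obtain y where y: "\<Phi> y = y" by auto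
  have "(rhs (e y) i has_integral (e y i t - x0 i)) {0..t}" if "i < N" "t \<ge> 0" for i t
  proof -
    have "apply_bcontfun y (discrete i, t) = exp (- (l * t)) * G y i t"
      using \<Phi>[of y "(discrete i, t)"] that by (simp add: y H_def discrete_inverse)
    then have "e y i t = G y i t" using that by (simp add: e_def exp_minus)
    then show ?thesis using e_int by (simp add: has_integral_iff G_def)
  qed
  then have "solution x0 (e y)" by (auto simp: solution_def e_def)
  then show ?thesis by blast
qed

text \<open>The identities \<open>sol_char\<close> are combined with the coefficients
  \<open>w i\<close> and multiplied by \<open>exp (s * T)\<close>. The transforms at
  \<open>T\<close> cancel because \<open>w\<close> is a left null vector. In the window terms
  \<open>x = y + c\<close>: the part of \<open>y\<close> tends to 0, and the constant part is killed
  by the zero row sums.\<close>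

lemma left_null_limit:
  assumes sol: "solution x0 x" and lim: "\<And>i. i < N \<Longrightarrow> (x i \<longlongrightarrow> c) at_top"
    and s: "Re s \<ge> 0" and w: "\<And>j. j < N \<Longrightarrow> (\<Sum>i<N. w i * char_entry s i j) = 0"
    and row: "\<And>k i. k < m \<Longrightarrow> i < N \<Longrightarrow> (\<Sum>j<N. L k i j) = 0"
  shows "((\<lambda>T. exp (s * of_real T) * (\<Sum>i<N. w i * of_real (x0 i))) \<longlongrightarrow> (\<Sum>i<N. w i * of_real c)) at_top"
proof (rule Lim_transform_eventually)
  define y where "y j t = x j t - c" for j t
  define q where "q j k T = exp (s * of_real (T - d k)) * (trunc_laplace (y j) T s - trunc_laplace (y j) (T - d k) s)" for j k T
  have ycont: "continuous_on {0..} (y j)" if "j < N" for j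
    unfolding y_def by (intro continuous_intros sol_cont[OF sol] that)
  have "(q j k \<longlongrightarrow> 0) at_top" if "j < N" "k < m" for j k
    unfolding q_def using that d_nonneg
    by (intro trunc_laplace_window_tendsto_0 ycont s) (auto simp: y_def[abs_def] intro!: tendsto_eq_intros lim)
  then have "((\<lambda>T. (\<Sum>i<N. w i * of_real (x i T)) - (\<Sum>i<N. w i * (\<Sum>k<m. \<Sum>j<N. of_real (L k i j) * q j k T)))
      \<longlongrightarrow> (\<Sum>i<N. w i * of_real c) - (\<Sum>i<N. w i * (\<Sum>k<m. \<Sum>j<N. of_real (L k i j) * 0))) at_top"
    by (intro tendsto_intros lim) auto
  then show "((\<lambda>T. (\<Sum>i<N. w i * of_real (x i T)) - (\<Sum>i<N. w i * (\<Sum>k<m. \<Sum>j<N. of_real (L k i j) * q j k T)))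
      \<longlongrightarrow> (\<Sum>i<N. w i * of_real c)) at_top" by simp
  show "\<forall>\<^sub>F T in at_top. (\<Sum>i<N. w i * of_real (x i T)) - (\<Sum>i<N. w i * (\<Sum>k<m. \<Sum>j<N. of_real (L k i j) * q j k T))
      = exp (s * of_real T) * (\<Sum>i<N. w i * of_real (x0 i))"
    using eventually_ge_at_top[of 0]
  proof eventually_elim
    case (elim T)
    define g where "g j k = trunc_laplace (x j) T s - trunc_laplace (x j) (T - d k) s" for j k
    have laps: "trunc_laplace (x j) T' s = trunc_laplace (y j) T' s + trunc_laplace (\<lambda>_. c) T' s" if "j < N" for j T'
      unfolding trunc_laplace_def y_def
      by (subst integral_add[symmetric])
        (use trunc_laplace_integrable[OF sol_cont[OF sol that], of 0] trunc_laplace_integrable[OF ycont[OF that], of 0]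
            trunc_laplace_integrable[of "\<lambda>_. c" 0] in \<open>auto simp: y_def algebra_simps\<close>)
    \<comment> \<open>The window contribution of the constant \<open>c\<close> does not depend on
      \<open>j\<close>, so it comes multiplied by the row sum of \<open>L k\<close>.\<close>
    define r where "r k = exp (s * of_real (T - d k)) * (trunc_laplace (\<lambda>_. c) T s - trunc_laplace (\<lambda>_. c) (T - d k) s)" for k
    have gq: "exp (s * of_real (T - d k)) * g j k = q j k T + r k" if "j < N" for j k
      unfolding g_def q_def r_def laps[OF that] by (simp add: algebra_simps)
    have ex: "exp (s * of_real T) * exp (- (of_real (d k) * s)) = exp (s * of_real (T - d k))" for k
      by (subst exp_add[symmetric]) (simp add: algebra_simps)
    have S: "exp (s * of_real T) * (\<Sum>k<m. \<Sum>j<N. of_real (L k i j) * exp (- (of_real (d k) * s)) * g j k)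
        = (\<Sum>k<m. \<Sum>j<N. of_real (L k i j) * q j k T)" if i: "i < N" for i
    proof -
      have "exp (s * of_real T) * (\<Sum>k<m. \<Sum>j<N. of_real (L k i j) * exp (- (of_real (d k) * s)) * g j k)
         = (\<Sum>k<m. \<Sum>j<N. of_real (L k i j) * (exp (s * of_real T) * exp (- (of_real (d k) * s)) * g j k))"
        by (simp only: sum_distrib_left mult_ac)
      also have "\<dots> = (\<Sum>k<m. \<Sum>j<N. of_real (L k i j) * (q j k T + r k))"
        unfolding ex by (intro sum.cong refl) (simp only: gq lessThan_iff)
      also have "\<dots> = (\<Sum>k<m. (\<Sum>j<N. of_real (L k i j) * q j k T) + of_real (\<Sum>j<N. L k i j) * r k)"
        by (simp add: distrib_left sum.distrib sum_distrib_right)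
      also have "\<dots> = (\<Sum>k<m. \<Sum>j<N. of_real (L k i j) * q j k T)"
        using row i by simp
      finally show ?thesis .
    qed
    have "0 = (\<Sum>j<N. (\<Sum>i<N. w i * char_entry s i j) * trunc_laplace (x j) T s)" using w by simp
    also have "\<dots> = (\<Sum>i<N. w i * (\<Sum>j<N. char_entry s i j * trunc_laplace (x j) T s))"
      unfolding sum_distrib_left sum_distrib_right by (subst sum.swap) (simp add: mult.assoc)
    also have "\<dots> = (\<Sum>i<N. w i * (of_real (x0 i) - exp (- s * of_real T) * of_real (x i T)
        + (\<Sum>k<m. \<Sum>j<N. of_real (L k i j) * exp (- (of_real (d k) * s)) * g j k)))"
      unfolding g_def by (intro sum.cong refl) (simp add: sol_char[OF sol _ elim])
    finally have "0 = exp (s * of_real T) * (\<Sum>i<N. w i * (of_real (x0 i) - exp (- s * of_real T) * of_real (x i T)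
        + (\<Sum>k<m. \<Sum>j<N. of_real (L k i j) * exp (- (of_real (d k) * s)) * g j k)))" by simp
    also have "\<dots> = (\<Sum>i<N. w i * (exp (s * of_real T) * of_real (x0 i) - of_real (x i T)
        + exp (s * of_real T) * (\<Sum>k<m. \<Sum>j<N. of_real (L k i j) * exp (- (of_real (d k) * s)) * g j k)))"
    proof (subst sum_distrib_left, rule sum.cong[OF refl])
      fix i
      have 1: "exp (s * of_real T) * exp (- s * of_real T) = 1" by (simp flip: exp_add)
      have "e * (w i * (a - b * z + h)) = w i * (e * a - e * b * z + e * h)" for e a b z h :: complex
        by (simp add: algebra_simps)
      from this[of "exp (s * of_real T)" _ "exp (- s * of_real T)", unfolded 1]
      show "exp (s * of_real T) * (w i * (of_real (x0 i) - exp (- s * of_real T) * of_real (x i T)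
        + (\<Sum>k<m. \<Sum>j<N. of_real (L k i j) * exp (- (of_real (d k) * s)) * g j k)))
        = w i * (exp (s * of_real T) * of_real (x0 i) - of_real (x i T)
        + exp (s * of_real T) * (\<Sum>k<m. \<Sum>j<N. of_real (L k i j) * exp (- (of_real (d k) * s)) * g j k))"
        by simp
    qed
    also have "\<dots> = (\<Sum>i<N. w i * (exp (s * of_real T) * of_real (x0 i) - of_real (x i T)
        + (\<Sum>k<m. \<Sum>j<N. of_real (L k i j) * q j k T)))"
      by (intro sum.cong refl) (simp add: S)
    also have "\<dots> = exp (s * of_real T) * (\<Sum>i<N. w i * of_real (x0 i))
        - ((\<Sum>i<N. w i * of_real (x i T)) - (\<Sum>i<N. w i * (\<Sum>k<m. \<Sum>j<N. of_real (L k i j) * q j k T)))"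
      by (simp add: distrib_left right_diff_distrib sum.distrib sum_subtractf sum_distrib_left mult_ac)
    finally show ?case by simp
  qed
qed

end

section \<open>Decay of solutions from a holomorphic transform\<close>

context delay_system
begin

text \<open>The error \<open>trunc_laplace (x i) T s - F i\<close> solves the characteristic system
  with right-hand side \<open>b i T\<close>, made of a boundary term and window terms. Beyond the
  growth rate \<open>2 * K\<close> these tend to 0, and diagonal dominance carries this over to the
  error.\<close>

lemma trunc_laplace_tendsto_transform:
  assumes sol: "solution x0 x" and s: "Re s > 2 * K"
    and F: "\<And>i. i < N \<Longrightarrow> (\<Sum>j<N. char_entry s i j * F j) = of_real (x0 i)" and i: "i < N"
  shows "((\<lambda>T. trunc_laplace (x i) T s) \<longlongrightarrow> F i) at_top"
proof -
  define \<delta> where "\<delta> = Re s - 2 * K"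
  have \<delta>: "\<delta> > 0" using s by (simp add: \<delta>_def)
  define B where "B = 2 * (\<Sum>i<N. \<bar>x0 i\<bar>)"
  have growth: "\<bar>x j t\<bar> \<le> B * exp (2 * K * t)" if "j < N" "t \<ge> 0" for j t
    using sol_growth[OF sol that] by (simp add: B_def)
  define b where "b i T = - exp (- s * of_real T) * of_real (x i T)
    + (\<Sum>k<m. \<Sum>j<N. of_real (L k i j) * exp (- (of_real (d k) * s)) * (trunc_laplace (x j) T s - trunc_laplace (x j) (T - d k) s))" for i T
  have eq: "s * (trunc_laplace (x i) T s - F i) + (\<Sum>j<N. coef s i j * (trunc_laplace (x j) T s - F j)) = b i T"
    if "i < N" "T \<ge> 0" for i T
  proof -
    have "s * (trunc_laplace (x i) T s - F i) + (\<Sum>j<N. coef s i j * (trunc_laplace (x j) T s - F j))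
      = (\<Sum>j<N. char_entry s i j * trunc_laplace (x j) T s) - (\<Sum>j<N. char_entry s i j * F j)"
      by (simp add: char_entry_sum[OF that(1)] right_diff_distrib sum_subtractf)
    then show ?thesis by (simp add: F[OF that(1)] sol_char[OF sol that] b_def)
  qed
  have x_lim: "((\<lambda>T. exp (- s * of_real T) * of_real (x i T)) \<longlongrightarrow> 0) at_top" if "i < N" for i
  proof (rule Lim_null_comparison)
    show "\<forall>\<^sub>F T in at_top. norm (exp (- s * of_real T) * complex_of_real (x i T)) \<le> B * exp (- \<delta> * T)"
      using eventually_ge_at_top[of 0]
    proof eventually_elim
      case (elim T)
      have "exp (- (Re s * T)) * \<bar>x i T\<bar> \<le> exp (- (Re s * T)) * (B * exp (2 * K * T))"
        by (intro mult_left_mono growth that elim) auto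
      also have "\<dots> = B * exp (- \<delta> * T)"
        unfolding mult.left_commute[of _ B] exp_add[symmetric] by (simp add: \<delta>_def algebra_simps)
      finally show ?case by (simp add: norm_mult)
    qed
    show "((\<lambda>T. B * exp (- \<delta> * T)) \<longlongrightarrow> 0) at_top" using \<delta> by real_asymp
  qed
  have l_lim: "((\<lambda>T. trunc_laplace (x j) T s - trunc_laplace (x j) (T - d k) s) \<longlongrightarrow> 0) at_top" if "j < N" "k < m" for j k
  proof (rule Lim_null_comparison)
    show "\<forall>\<^sub>F T in at_top. norm (trunc_laplace (x j) T s - trunc_laplace (x j) (T - d k) s) \<le> B * exp (- \<delta> * (T - d k)) / \<delta>"
      using eventually_ge_at_top[of "d k"]
    proof eventually_elim
      case (elim T)
      have "norm (trunc_laplace (x j) T s - trunc_laplace (x j) (T - d k) s)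
          \<le> B * (exp ((2 * K - Re s) * T) - exp ((2 * K - Re s) * (T - d k))) / (2 * K - Re s)"
        by (rule trunc_laplace_diff_bound[OF sol_cont[OF sol that(1)] growth[OF that(1)]])
          (use elim d_nonneg[OF that(2)] s in auto)
      also have "\<dots> = B * (exp (- \<delta> * (T - d k)) - exp (- \<delta> * T)) / \<delta>"
        using \<delta> by (simp add: \<delta>_def divide_simps) (simp add: algebra_simps)
      also have "\<dots> \<le> B * exp (- \<delta> * (T - d k)) / \<delta>"
        using \<delta> by (intro divide_right_mono mult_left_mono) (auto simp: B_def intro!: sum_nonneg)
      finally show ?case .
    qed
    show "((\<lambda>T. B * exp (- \<delta> * (T - d k)) / \<delta>) \<longlongrightarrow> 0) at_top" using \<delta> by real_asymp
  qed
  have "(b i \<longlongrightarrow> 0) at_top" if "i < N" for i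
  proof -
    have "((\<lambda>T. - (exp (- s * of_real T) * of_real (x i T))
      + (\<Sum>k<m. \<Sum>j<N. of_real (L k i j) * exp (- (of_real (d k) * s)) * (trunc_laplace (x j) T s - trunc_laplace (x j) (T - d k) s)))
      \<longlongrightarrow> - 0 + (\<Sum>k<m. \<Sum>j<N. of_real (L k i j) * exp (- (of_real (d k) * s)) * 0)) at_top"
      by (intro tendsto_intros x_lim l_lim that) auto
    then show ?thesis by (simp add: b_def[abs_def])
  qed
  then have "((\<lambda>T. (\<Sum>i<N. norm (b i T)) / (norm s - K)) \<longlongrightarrow> (\<Sum>i<N. norm (0::complex)) / (norm s - K)) at_top"
    using s K_pos complex_Re_le_cmod[of s] by (intro tendsto_intros) auto
  then have lim: "((\<lambda>T. (\<Sum>i<N. norm (b i T)) / (norm s - K)) \<longlongrightarrow> 0) at_top" by simp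
  have "((\<lambda>T. trunc_laplace (x i) T s - F i) \<longlongrightarrow> 0) at_top"
  proof (rule Lim_null_comparison[OF _ lim])
    show "\<forall>\<^sub>F T in at_top. norm (trunc_laplace (x i) T s - F i) \<le> (\<Sum>i<N. norm (b i T)) / (norm s - K)"
      using eventually_ge_at_top[of 0]
    proof eventually_elim
      case (elim T)
      show ?case
      proof (rule diagonally_dominant_bound[OF eq[OF _ elim] sum_norm_coef _ _ i])
        show "norm (b i T) \<le> (\<Sum>i<N. norm (b i T))" if "i < N" for i
          using that by (intro member_le_sum) auto
      qed (use s K_pos complex_Re_le_cmod[of s] in auto)
    qed
  qed
  then show ?thesis by (simp add: LIM_zero_iff)
qed

text \<open>On the compact part \<open>norm s \<le> 2 * K + 1\<close> continuity suffices. Outside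
  it diagonal dominance gives \<open>\<beta> / (norm s - K)\<close>, and there
  \<open>1 + norm s \<le> 2 * (norm s - K)\<close>. The condition \<open>\<epsilon>' \<le> 1\<close>
  keeps \<open>s\<close> where \<open>K\<close> bounds the coefficients.\<close>

lemma transform_decay:
  assumes \<epsilon>: "0 < \<epsilon>" "\<epsilon> < \<epsilon>'" "\<epsilon>' \<le> 1" and hol: "\<And>i. i < N \<Longrightarrow> F i holomorphic_on {s. Re s > - \<epsilon>'}"
    and F: "\<And>s i. Re s > - \<epsilon>' \<Longrightarrow> i < N \<Longrightarrow> (\<Sum>j<N. char_entry s i j * F j s) = of_real (x0 i)" and i: "i < N"
  shows "\<exists>C. \<forall>s. Re s \<ge> - \<epsilon> \<longrightarrow> norm (F i s) * (1 + norm s) \<le> C"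
proof -
  define \<beta> where "\<beta> = (\<Sum>i<N. \<bar>x0 i\<bar>)"
  have \<beta>: "\<beta> \<ge> 0" by (auto simp: \<beta>_def intro!: sum_nonneg)
  define S where "S = {s. Re s \<ge> - \<epsilon>} \<inter> cball 0 (2 * K + 1)"
  have "compact S" unfolding S_def
    by (intro closed_Int_compact closed_halfspace_Re_ge compact_cball)
  moreover have "continuous_on S (\<lambda>s. norm (F i s) * (1 + norm s))"
    by (intro continuous_intros holomorphic_on_imp_continuous_on holomorphic_on_subset[OF hol[OF i]])
      (use \<epsilon> in \<open>auto simp: S_def\<close>)
  ultimately have "bounded ((\<lambda>s. norm (F i s) * (1 + norm s)) ` S)"
    by (intro compact_imp_bounded compact_continuous_image)
  then obtain C where C: "\<And>s. s \<in> S \<Longrightarrow> norm (F i s) * (1 + norm s) \<le> C"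
    by (auto simp: bounded_iff)
  have "norm (F i s) * (1 + norm s) \<le> max C (2 * \<beta>)" if s: "Re s \<ge> - \<epsilon>" for s
  proof (cases "norm s \<le> 2 * K + 1")
    case True
    then show ?thesis using C[of s] s by (auto simp: S_def)
  next
    case False
    have "norm (F i s) \<le> \<beta> / (norm s - K)"
    proof (rule diagonally_dominant_bound[OF _ sum_norm_coef _ _ i])
      show "s * F i s + (\<Sum>j<N. coef s i j * F j s) = of_real (x0 i)" if "i < N" for i
        using F[of s i] s \<epsilon> that by (simp add: char_entry_sum)
      show "norm (complex_of_real (x0 i)) \<le> \<beta>" if "i < N" for i
        using that member_le_sum[of i "{..<N}" "\<lambda>i. \<bar>x0 i\<bar>"] by (auto simp: \<beta>_def)
    qed (use s \<epsilon> False K_pos in auto)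
    then have "norm (F i s) * (1 + norm s) \<le> \<beta> / (norm s - K) * (1 + norm s)"
      by (rule mult_right_mono) auto
    also have "\<dots> \<le> \<beta> / (norm s - K) * (2 * (norm s - K))"
      using False \<beta> K_pos by (intro mult_left_mono divide_nonneg_nonneg) auto
    also have "\<dots> = 2 * \<beta>"
    proof -
      have "norm s - K \<noteq> 0" using False K_pos by linarith
      then have "\<beta> / (norm s - K) * (norm s - K) = \<beta>" by simp
      then show ?thesis by (simp only: mult.left_commute[of _ 2])
    qed
    finally show ?thesis by simp
  qed
  then show ?thesis by blast
qed

text \<open>The contour estimate gives convergence of the integrals of all components. At
  \<open>s = 0\<close> the identity \<open>sol_laplace\<close> expresses \<open>x i T\<close>
  through these integrals, and the equation for \<open>F\<close> at 0 says that the resulting limit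
  is 0.\<close>

lemma sol_tendsto_0:
  assumes sol: "solution x0 x" and \<epsilon>: "0 < \<epsilon>'" "\<epsilon>' \<le> 1"
    and hol: "\<And>i. i < N \<Longrightarrow> F i holomorphic_on {s. Re s > - \<epsilon>'}"
    and F: "\<And>s i. Re s > - \<epsilon>' \<Longrightarrow> i < N \<Longrightarrow> (\<Sum>j<N. char_entry s i j * F j s) = of_real (x0 i)" and i: "i < N"
  shows "(x i \<longlongrightarrow> 0) at_top"
proof -
  have trunc_laplace: "((\<lambda>T. trunc_laplace (x j) T 0) \<longlongrightarrow> F j 0) at_top" if j: "j < N" for j
  proof -
    have e: "0 < \<epsilon>' / 2" "\<epsilon>' / 2 < \<epsilon>'" using \<epsilon> by auto
    obtain C where C: "\<And>s. Re s \<ge> - (\<epsilon>' / 2) \<Longrightarrow> norm (F j s) * (1 + norm s) \<le> C"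
      using transform_decay[OF e \<epsilon>(2) hol F j] by auto
    show ?thesis
    proof (rule trunc_laplace_tendsto_at_0[OF sol_cont[OF sol j] sol_growth[OF sol j] _ e hol[OF j] C])
      show "((\<lambda>T. trunc_laplace (x j) T s) \<longlongrightarrow> F j s) at_top" if "Re s > 2 * K" for s
        by (rule trunc_laplace_tendsto_transform[OF sol that F j]) (use that K_pos \<epsilon> in auto)
    qed (use K_pos in auto)
  qed
  have shift: "((\<lambda>T. trunc_laplace (x j) (T - d k) 0) \<longlongrightarrow> F j 0) at_top" if "j < N" for j k
  proof -
    have "filterlim (\<lambda>T. T - d k) at_top at_top" by real_asymp
    from filterlim_compose[OF trunc_laplace[OF that] this] show ?thesis .
  qed
  have "((\<lambda>T. of_real (x0 i) - (\<Sum>k<m. \<Sum>j<N. of_real (L k i j) * trunc_laplace (x j) (T - d k) 0))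
      \<longlongrightarrow> of_real (x0 i) - (\<Sum>k<m. \<Sum>j<N. of_real (L k i j) * F j 0)) at_top"
    by (intro tendsto_intros shift) auto
  moreover have "(\<Sum>k<m. \<Sum>j<N. of_real (L k i j) * F j 0) = (\<Sum>j<N. coef 0 i j * F j 0)"
    unfolding coef_def sum_distrib_right by (subst sum.swap) simp
  then have "of_real (x0 i) - (\<Sum>k<m. \<Sum>j<N. of_real (L k i j) * F j 0) = 0"
    using F[of 0 i] \<epsilon> i by (simp add: char_entry_sum)
  moreover have "\<forall>\<^sub>F T in at_top. of_real (x0 i) - (\<Sum>k<m. \<Sum>j<N. of_real (L k i j) * trunc_laplace (x j) (T - d k) 0)
      = complex_of_real (x i T)"
    using eventually_ge_at_top[of 0]
  proof eventually_elim
    case (elim T)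
    show ?case using sol_laplace[OF sol i elim, of 0] by (simp add: algebra_simps)
  qed
  ultimately have "((\<lambda>T. complex_of_real (x i T)) \<longlongrightarrow> 0) at_top"
    using Lim_transform_eventually by fastforce
  then show ?thesis using tendsto_of_real_iff[of "x i" 0 at_top, where ?'a = complex] by simp
qed

end

section \<open>Consensus and characteristic roots\<close>

lemma holomorphic_on_det_mat:
  assumes "\<And>i j. i < n \<Longrightarrow> j < n \<Longrightarrow> (\<lambda>s. A s i j) holomorphic_on S"
  shows "(\<lambda>s. det (mat n n (\<lambda>(i, j). A s i j))) holomorphic_on S"
proof -
  have "det (mat n n (\<lambda>(i, j). A s i j)) = (\<Sum>p \<in> {p. p permutes {0..<n}}. signof p * (\<Prod>i = 0..<n. A s i (p i)))" for s
    by (subst det_def'[of _ n]) (auto intro!: sum.cong prod.cong simp: permutes_in_image)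
  then show ?thesis
    by (auto intro!: holomorphic_intros assms simp: permutes_in_image)
qed

lemma mult_mat_vec_index_sum:
  assumes "A \<in> carrier_mat n N" "v \<in> carrier_vec N" "i < n"
  shows "(A *\<^sub>v v) $ i = (\<Sum>j<N. A $$ (i, j) * v $ j)"
  using assms by (auto simp: scalar_prod_def atLeast0LessThan intro!: sum.cong)

lemma mult_mat_index_sum:
  assumes "A \<in> carrier_mat n N" "B \<in> carrier_mat N k" "i < n" "j < k"
  shows "(A * B) $$ (i, j) = (\<Sum>l<N. A $$ (i, l) * B $$ (l, j))"
  using assms by (auto simp: scalar_prod_def atLeast0LessThan intro!: sum.cong)

lemma det_zero_imp_left_null:
  fixes A :: "'a::field mat"
  assumes "A \<in> carrier_mat n n" "det A = 0"
  obtains w where "\<exists>i<n. w i \<noteq> 0" "\<And>j. j < n \<Longrightarrow> (\<Sum>i<n. w i * A $$ (i, j)) = 0"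
proof -
  have "det (transpose_mat A) = 0" using assms det_transpose by metis
  then obtain v where v: "v \<in> carrier_vec n" "v \<noteq> 0\<^sub>v n" "transpose_mat A *\<^sub>v v = 0\<^sub>v n"
    using det_0_iff_vec_prod_zero_field[of "transpose_mat A" n] assms(1) by auto
  show ?thesis
  proof (rule that[of "\<lambda>i. v $ i"])
    show "\<exists>i<n. v $ i \<noteq> 0" using v(1,2) by (metis carrier_vecD eq_vecI index_zero_vec)
    fix j assume j: "j < n"
    have "(transpose_mat A *\<^sub>v v) $ j = (\<Sum>i<n. transpose_mat A $$ (j, i) * v $ i)"
      using assms(1) v(1) j by (intro mult_mat_vec_index_sum) auto
    also have "\<dots> = (\<Sum>i<n. v $ i * A $$ (i, j))"
      using assms(1) j by (intro sum.cong) (auto simp: mult.commute)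
    finally show "(\<Sum>i<n. v $ i * A $$ (i, j)) = 0" using v(3) j by simp
  qed
qed

section \<open>The conserved functional and the reduced determinant\<close>

locale consensus_system = delay_system +
  fixes a :: "nat \<Rightarrow> real"
  assumes a_pos: "\<And>i. i < N \<Longrightarrow> a i > 0"
    and row_sum: "\<And>k i. k < m \<Longrightarrow> i < N \<Longrightarrow> (\<Sum>j<N. L k i j) = 0"
    and col_sum: "\<And>k j. k < m \<Longrightarrow> j < N \<Longrightarrow> (\<Sum>i<N. a i * L k i j) = 0"
begin

definition char_mat :: "complex \<Rightarrow> complex mat" where
  "char_mat s = mat N N (\<lambda>(i, j). char_entry s i j)"

text \<open>Replacing the first row by the conserved functional removes exactly the zero at the origin.\<close>
definition reduced_mat :: "complex \<Rightarrow> complex mat" where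
  "reduced_mat s = mat N N (\<lambda>(i, j). if i = 0 then of_real (a j) else char_entry s i j)"

lemma char_carriers [simp]: "char_mat s \<in> carrier_mat N N" "reduced_mat s \<in> carrier_mat N N"
  by (auto simp: char_mat_def reduced_mat_def)

lemma sum_a_pos: "(\<Sum>j<N. a j) > 0"
  using a_pos N_pos by (intro sum_pos) auto

lemma char_row_sum: "i < N \<Longrightarrow> (\<Sum>j<N. char_entry s i j) = s"
proof -
  assume i: "i < N"
  have "(\<Sum>j<N. coef s i j) = (\<Sum>k<m. of_real (\<Sum>j<N. L k i j) * exp (- (of_real (d k) * s)))"
    unfolding coef_def by (subst sum.swap) (simp add: sum_distrib_right)
  then show ?thesis using char_entry_sum[OF i, of s "\<lambda>_. 1"] row_sum[OF _ i] by simp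
qed

lemma char_col_sum:
  assumes "j < N"
  shows "(\<Sum>i<N. of_real (a i) * char_entry s i j) = s * of_real (a j)"
proof -
  have "(\<Sum>i<N. of_real (a i) * coef s i j) = (\<Sum>k<m. of_real (\<Sum>i<N. a i * L k i j) * exp (- (of_real (d k) * s)))"
    unfolding coef_def sum_distrib_left by (subst sum.swap) (simp add: sum_distrib_right mult.assoc)
  then show ?thesis using col_sum[OF _ assms] assms
    by (simp add: char_entry_def distrib_left sum.distrib if_distrib[of "\<lambda>z. _ * z"] mult.commute cong: if_cong)
qed

text \<open>\<open>W\<close> replaces the first row by the \<open>a\<close>-weighted sum of all
  rows, and \<open>S\<close> multiplies the first row by \<open>s\<close>. The column identity
  \<open>char_col_sum\<close> says that \<open>W * char_mat s = S * reduced_mat s\<close>, and both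
  multipliers are triangular.\<close>

lemma det_char_mat: "of_real (a 0) * det (char_mat s) = s * det (reduced_mat s)"
proof -
  define W where "W = mat N N (\<lambda>(i, j). if i = 0 then complex_of_real (a j) else if i = j then 1 else 0)"
  define S where "S = mat N N (\<lambda>(i, j). if i = j then if i = 0 then s else 1 else 0)"
  have W: "W \<in> carrier_mat N N" and S: "S \<in> carrier_mat N N" by (auto simp: W_def S_def)
  have prod0: "(\<Prod>i = 0..<N. if i = 0 then z else 1) = z" for z :: complex
    using N_pos by (simp add: prod.delta')
  have "upper_triangular W" by (auto simp: W_def)
  then have "det W = (\<Prod>i = 0..<N. W $$ (i, i))"
    using det_upper_triangular[OF _ W] W by (simp add: prod_list_diag_prod)
  also have "\<dots> = (\<Prod>i = 0..<N. if i = 0 then of_real (a 0) else 1)"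
    by (rule prod.cong) (auto simp: W_def)
  finally have detW: "det W = of_real (a 0)" by (simp only: prod0)
  have "upper_triangular S" by (auto simp: S_def)
  then have "det S = (\<Prod>i = 0..<N. S $$ (i, i))"
    using det_upper_triangular[OF _ S] S by (simp add: prod_list_diag_prod)
  also have "\<dots> = (\<Prod>i = 0..<N. if i = 0 then s else 1)"
    by (rule prod.cong) (auto simp: S_def)
  finally have detS: "det S = s" by (simp only: prod0)
  have "W * char_mat s = S * reduced_mat s"
  proof (rule eq_matI)
    fix i j assume "i < dim_row (S * reduced_mat s)" "j < dim_col (S * reduced_mat s)"
    then have ij: "i < N" "j < N" by (auto simp: S_def reduced_mat_def)
    have "(W * char_mat s) $$ (i, j) = (\<Sum>l<N. W $$ (i, l) * char_mat s $$ (l, j))"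
      by (rule mult_mat_index_sum[OF W char_carriers(1) ij])
    also have "\<dots> = (\<Sum>l<N. (if i = 0 then of_real (a l) else if i = l then 1 else 0) * char_entry s l j)"
      using ij by (intro sum.cong) (auto simp: W_def char_mat_def)
    also have "\<dots> = (if i = 0 then s * of_real (a j) else char_entry s i j)"
      using ij by (simp add: char_col_sum if_distrib[of "\<lambda>z. z * _"] cong: if_cong)
    also have "\<dots> = (\<Sum>l<N. (if i = l then if i = 0 then s else 1 else 0) * reduced_mat s $$ (l, j))"
      using ij by (simp add: reduced_mat_def if_distrib[of "\<lambda>z. z * _"] cong: if_cong)
    also have "\<dots> = (\<Sum>l<N. S $$ (i, l) * reduced_mat s $$ (l, j))"
      using ij by (intro sum.cong) (auto simp: S_def)
    also have "\<dots> = (S * reduced_mat s) $$ (i, j)"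
      by (rule mult_mat_index_sum[OF S char_carriers(2) ij, symmetric])
    finally show "(W * char_mat s) $$ (i, j) = (S * reduced_mat s) $$ (i, j)" .
  qed (auto simp: W_def S_def char_mat_def reduced_mat_def)
  then show ?thesis
    using det_mult[OF W char_carriers(1), of s] det_mult[OF S char_carriers(2), of s] by (simp add: detW detS)
qed

lemma holomorphic_char_entry: "(\<lambda>s. char_entry s i j) holomorphic_on S"
  unfolding char_entry_def coef_def by (cases "i = j") (auto intro!: holomorphic_intros)

lemma holomorphic_reduced_entry:
  "(\<lambda>s. if i = 0 then of_real (a j) else char_entry s i j) holomorphic_on S"
  using holomorphic_char_entry by (cases "i = 0") (auto intro!: holomorphic_intros)

lemma holomorphic_det_reduced: "(\<lambda>s. det (reduced_mat s)) holomorphic_on S"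
  unfolding reduced_mat_def by (intro holomorphic_on_det_mat holomorphic_reduced_entry)

lemma holomorphic_cofactor_reduced:
  assumes "i < N" "j < N"
  shows "(\<lambda>s. cofactor (reduced_mat s) i j) holomorphic_on S"
proof -
  \<comment> \<open>\<open>?h l\<close> renumbers the remaining indices so that \<open>l\<close> is
    skipped.\<close>
  let ?h = "\<lambda>l p. if p < l then p else Suc p"
  have "mat_delete (reduced_mat s) i j = mat (N - 1) (N - 1)
      (\<lambda>(p, q). (if ?h i p = 0 then of_real (a (?h j q)) else char_entry s (?h i p) (?h j q)))" for s
    using assms by (auto simp: mat_delete_def reduced_mat_def intro!: eq_matI)
  then show ?thesis
    unfolding cofactor_def
    by (auto intro!: holomorphic_intros holomorphic_on_det_mat holomorphic_reduced_entry)
qed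

text \<open>Up to a constant, \<open>f s\<close> is \<open>s * det (reduced_mat s)\<close>, so by
  the product rule \<open>deriv f 0\<close> is a multiple of the reduced determinant at 0. That the
  root at 0 is single thus means that the reduced determinant does not vanish there.\<close>

lemma characteristic_roots_iff:
  fixes f defines "f \<equiv> \<lambda>s. det (char_mat s)"
  shows "(f 0 = 0 \<and> deriv f 0 \<noteq> 0 \<and> (\<forall>s. f s = 0 \<longrightarrow> s = 0 \<or> Re s < 0))
    \<longleftrightarrow> (\<forall>s. Re s \<ge> 0 \<longrightarrow> det (reduced_mat s) \<noteq> 0)"
proof -
  have a0: "a 0 \<noteq> 0" using a_pos[of 0] N_pos by auto
  have f: "f = (\<lambda>s. s * (det (reduced_mat s) / of_real (a 0)))"
    unfolding f_def using det_char_mat a0 by (auto simp: field_simps)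
  have "(\<lambda>s. det (reduced_mat s) / of_real (a 0)) holomorphic_on UNIV"
    using a0 by (intro holomorphic_intros holomorphic_det_reduced) auto
  then have "(\<lambda>s. det (reduced_mat s) / of_real (a 0)) field_differentiable at 0"
    by (auto simp: holomorphic_on_def)
  then obtain D where "((\<lambda>s. det (reduced_mat s) / of_real (a 0)) has_field_derivative D) (at 0)"
    by (auto simp: field_differentiable_def)
  then have "(f has_field_derivative (1 * (det (reduced_mat 0) / of_real (a 0)) + D * 0)) (at 0)"
    unfolding f by (intro DERIV_mult DERIV_ident)
  then have "deriv f 0 = det (reduced_mat 0) / of_real (a 0)"
    by (simp add: DERIV_imp_deriv)
  then show ?thesis using a0 by (auto simp: f not_less)
qed

text \<open>By diagonal dominance the zeros with \<open>Re s \<ge> - 1\<close> lie in a disc of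
  radius \<open>K\<close>, so they form a compact set. Their largest real part is attained and hence
  negative.\<close>

lemma spectral_gap:
  assumes "\<And>s. Re s \<ge> 0 \<Longrightarrow> det (reduced_mat s) \<noteq> 0"
  obtains \<epsilon> where "0 < \<epsilon>" "\<epsilon> \<le> 1" "\<And>s. Re s > - \<epsilon> \<Longrightarrow> det (reduced_mat s) \<noteq> 0"
proof -
  have large: "norm s \<le> K" if s: "Re s \<ge> - 1" "det (reduced_mat s) = 0" for s
  proof (rule ccontr)
    assume n: "\<not> norm s \<le> K"
    have "det (char_mat s) = 0" using det_char_mat[of s] s a_pos[of 0] N_pos by auto
    then obtain v where v: "v \<in> carrier_vec N" "v \<noteq> 0\<^sub>v N" "char_mat s *\<^sub>v v = 0\<^sub>v N"
      using det_0_iff_vec_prod_zero_field[of "char_mat s" N] by auto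
    have "norm (v $ i) \<le> 0 / (norm s - K)" if i: "i < N" for i
    proof (rule diagonally_dominant_bound[OF _ sum_norm_coef _ _ i, where b = "\<lambda>_. 0"])
      fix i assume i: "i < N"
      have "0 = (char_mat s *\<^sub>v v) $ i" using v i by simp
      also have "\<dots> = (\<Sum>j<N. char_entry s i j * v $ j)"
        unfolding mult_mat_vec_index_sum[OF char_carriers(1) v(1) i] using i by (simp add: char_mat_def)
      finally show "s * v $ i + (\<Sum>j<N. coef s i j * v $ j) = 0" using i by (simp add: char_entry_sum)
    qed (use n s in auto)
    then have "v $ i = 0" if "i < N" for i using that by simp
    then have "v = 0\<^sub>v N" using v(1) by (intro eq_vecI) auto
    with v(2) show False by simp
  qed
  define Z where "Z = {s. det (reduced_mat s) = 0} \<inter> ({s. Re s \<ge> - 1} \<inter> cball 0 K)"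
  have "closed {s. det (reduced_mat s) = 0}"
    using continuous_closed_preimage_constant[of UNIV "\<lambda>s. det (reduced_mat s)" 0]
      holomorphic_on_imp_continuous_on[OF holomorphic_det_reduced] by simp
  then have "compact Z" unfolding Z_def
    by (intro closed_Int_compact closed_halfspace_Re_ge compact_cball)
  have Z: "s \<in> Z" if "Re s \<ge> - 1" "det (reduced_mat s) = 0" for s
    using large that by (auto simp: Z_def)
  show ?thesis
  proof (cases "Z = {}")
    case True
    then show ?thesis using Z by (intro that[of 1]) fastforce+
  next
    case False
    obtain z where z: "z \<in> Z" "\<And>s. s \<in> Z \<Longrightarrow> Re s \<le> Re z"
      using continuous_attains_sup[OF \<open>compact Z\<close> False continuous_on_Re[OF continuous_on_id]] by blast
    have "Re z < 0" using assms[of z] z(1) by (auto simp: Z_def not_less[symmetric])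
    show ?thesis
    proof (rule that[of "min 1 (- Re z)"])
      fix s assume s: "Re s > - min 1 (- Re z)"
      show "det (reduced_mat s) \<noteq> 0"
      proof
        assume "det (reduced_mat s) = 0"
        then have "Re s \<le> Re z" using s by (intro z(2) Z) auto
        with s show False by auto
      qed
    qed (use \<open>Re z < 0\<close> in auto)
  qed
qed

text \<open>The constant is subtracted only for \<open>t \<ge> 0\<close>, to keep the history zero.
  In each delayed term the cut-off is the same for all \<open>j\<close>, so the zero row sums remove
  it.\<close>

lemma solution_shift:
  assumes "solution x0 x"
  shows "solution (\<lambda>i. x0 i - c) (\<lambda>i t. x i t - (if t \<ge> 0 then c else 0))"
proof -
  have "rhs (\<lambda>i t. x i t - (if t \<ge> 0 then c else 0)) i t = rhs x i t" if "i < N" for i t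
  proof -
    have "rhs (\<lambda>i t. x i t - (if t \<ge> 0 then c else 0)) i t
        = rhs x i t + (\<Sum>k<m. (\<Sum>j<N. L k i j) * (if t - d k \<ge> 0 then c else 0))"
      by (simp add: rhs_def right_diff_distrib sum_subtractf sum_distrib_right)
    also have "(\<Sum>k<m. (\<Sum>j<N. L k i j) * (if t - d k \<ge> 0 then c else 0)) = 0"
      using row_sum[OF _ that] by (intro sum.neutral) auto
    finally show ?thesis by simp
  qed
  then have "rhs (\<lambda>i t. x i t - (if t \<ge> 0 then c else 0)) i = rhs x i" if "i < N" for i
    using that by (simp add: fun_eq_iff)
  then show ?thesis using assms by (auto simp: solution_def)
qed

text \<open>The first equation of the characteristic system is missing from the reduced one. The
  first reduced row says that \<open>v\<close> is annihilated by \<open>a\<close>, so the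
  \<open>a\<close>-weighted sum of all characteristic rows is 0, as is that of \<open>b\<close>; as
  \<open>a 0 > 0\<close>, the missing equation follows.\<close>

lemma reduced_imp_char:
  assumes red: "\<And>i. i < N \<Longrightarrow> (\<Sum>j<N. reduced_mat s $$ (i, j) * v j) = (if i = 0 then 0 else b i)"
    and b: "(\<Sum>i<N. of_real (a i) * b i) = 0" and i: "i < N"
  shows "(\<Sum>j<N. char_entry s i j * v j) = b i"
proof -
  have pos: "(\<Sum>j<N. char_entry s i j * v j) = b i" if "i < N" "i \<noteq> 0" for i
    using red[OF that(1)] that by (simp add: reduced_mat_def)
  have av: "(\<Sum>j<N. of_real (a j) * v j) = 0"
    using red[OF N_pos] N_pos by (simp add: reduced_mat_def)
  have "(\<Sum>i<N. of_real (a i) * (\<Sum>j<N. char_entry s i j * v j)) = (\<Sum>j<N. (\<Sum>i<N. of_real (a i) * char_entry s i j) * v j)"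
    unfolding sum_distrib_left sum_distrib_right by (subst sum.swap) (simp add: mult.assoc)
  also have "\<dots> = s * (\<Sum>j<N. of_real (a j) * v j)"
    by (simp add: char_col_sum sum_distrib_left mult.assoc)
  finally have "(\<Sum>i<N. of_real (a i) * (\<Sum>j<N. char_entry s i j * v j)) - (\<Sum>i<N. of_real (a i) * b i) = 0"
    using av b by simp
  then have "(\<Sum>i<N. of_real (a i) * ((\<Sum>j<N. char_entry s i j * v j) - b i)) = 0"
    by (simp add: right_diff_distrib sum_subtractf)
  also have "(\<Sum>i<N. of_real (a i) * ((\<Sum>j<N. char_entry s i j * v j) - b i))
      = (\<Sum>i\<in>{0}. of_real (a i) * ((\<Sum>j<N. char_entry s i j * v j) - b i))"
    using N_pos pos by (intro sum.mono_neutral_right) auto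
  finally have "(\<Sum>j<N. char_entry s 0 j * v j) = b 0"
    using a_pos[OF N_pos] by simp
  with pos i show ?thesis by (cases "i = 0") auto
qed

lemma consensus_if:
  assumes roots: "\<And>s. Re s \<ge> 0 \<Longrightarrow> det (reduced_mat s) \<noteq> 0" and sol: "solution x0 x" and i: "i < N"
  shows "(x i \<longlongrightarrow> (\<Sum>j<N. a j * x0 j) / (\<Sum>j<N. a j)) at_top"
proof -
  define c where "c = (\<Sum>j<N. a j * x0 j) / (\<Sum>j<N. a j)"
  obtain \<epsilon> where \<epsilon>: "0 < \<epsilon>" "\<epsilon> \<le> 1" and gap: "\<And>s. Re s > - \<epsilon> \<Longrightarrow> det (reduced_mat s) \<noteq> 0"
    using spectral_gap[OF roots] by blast
  \<comment> \<open>The first entry is the value of the conserved functional, which is 0 after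
    subtracting the weighted mean \<open>c\<close>.\<close>
  define b where "b l = (if l = 0 then 0 else complex_of_real (x0 l - c))" for l
  \<comment> \<open>Cramer's rule writes the solution of the reduced system as a quotient of
    holomorphic functions.\<close>
  define F where "F j s = (\<Sum>l<N. cofactor (reduced_mat s) l j * b l) / det (reduced_mat s)" for j s
  have hol: "F j holomorphic_on {s. Re s > - \<epsilon>}" if "j < N" for j
    unfolding F_def[abs_def] using gap that
    by (intro holomorphic_intros holomorphic_det_reduced holomorphic_cofactor_reduced) auto
  have F: "(\<Sum>j<N. char_entry s i j * F j s) = of_real (x0 i - c)" if s: "Re s > - \<epsilon>" and "i < N" for s i
  proof (rule reduced_imp_char[OF _ _ \<open>i < N\<close>])
    fix i assume i: "i < N"
    let ?R = "reduced_mat s"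
    have adj: "?R * adj_mat ?R = det ?R \<cdot>\<^sub>m 1\<^sub>m N" "adj_mat ?R \<in> carrier_mat N N"
      using adj_mat[OF char_carriers(2)] by auto
    have "(\<Sum>j<N. ?R $$ (i, j) * cofactor ?R l j) = (if i = l then det ?R else 0)" if l: "l < N" for l
    proof -
      have "(?R * adj_mat ?R) $$ (i, l) = (\<Sum>j<N. ?R $$ (i, j) * adj_mat ?R $$ (j, l))"
        by (rule mult_mat_index_sum[OF char_carriers(2) adj(2) i l])
      also have "\<dots> = (\<Sum>j<N. ?R $$ (i, j) * cofactor ?R l j)"
        using l by (intro sum.cong) (auto simp: adj_mat_def reduced_mat_def)
      finally have "(\<Sum>j<N. ?R $$ (i, j) * cofactor ?R l j) = (det ?R \<cdot>\<^sub>m 1\<^sub>m N) $$ (i, l)"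
        by (simp only: adj(1))
      then show ?thesis using i l by simp
    qed
    note cof = this
    have "(\<Sum>j<N. ?R $$ (i, j) * F j s) = (\<Sum>j<N. \<Sum>l<N. ?R $$ (i, j) * cofactor ?R l j * b l) / det ?R"
      by (simp add: F_def sum_divide_distrib sum_distrib_left mult.assoc)
    also have "(\<Sum>j<N. \<Sum>l<N. ?R $$ (i, j) * cofactor ?R l j * b l) = (\<Sum>l<N. (\<Sum>j<N. ?R $$ (i, j) * cofactor ?R l j) * b l)"
      by (subst sum.swap) (simp add: sum_distrib_right)
    also have "\<dots> = (\<Sum>l<N. if i = l then det ?R * b l else 0)"
      by (intro sum.cong refl) (simp add: cof)
    also have "\<dots> = det ?R * b i" using i by simp
    finally show "(\<Sum>j<N. ?R $$ (i, j) * F j s) = (if i = 0 then 0 else of_real (x0 i - c))"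
      using gap[OF s] by (simp add: b_def)
  next
    have "(\<Sum>i<N. a i * (x0 i - c)) = 0"
    proof -
      have "(\<Sum>i<N. a i * (x0 i - c)) = (\<Sum>i<N. a i * x0 i) - (\<Sum>i<N. a i) * c"
        by (simp only: right_diff_distrib sum_subtractf sum_distrib_right)
      then show ?thesis using sum_a_pos by (simp add: c_def)
    qed
    then have "of_real (\<Sum>i<N. a i * (x0 i - c)) = complex_of_real 0" by simp
    then show "(\<Sum>i<N. of_real (a i) * complex_of_real (x0 i - c)) = 0" by simp
  qed
  have "((\<lambda>t. x i t - (if t \<ge> 0 then c else 0)) \<longlongrightarrow> 0) at_top"
    by (rule sol_tendsto_0[OF solution_shift[OF sol] \<epsilon> hol F i])
  then have "((\<lambda>t. x i t - c) \<longlongrightarrow> 0) at_top"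
  proof (rule Lim_transform_eventually)
    show "\<forall>\<^sub>F t in at_top. x i t - (if t \<ge> 0 then c else 0) = x i t - c"
      using eventually_ge_at_top[of 0] by eventually_elim simp
  qed
  then show ?thesis by (simp add: c_def LIM_zero_iff)
qed

text \<open>For \<open>s\<close> other than 0 a left null vector of \<open>char_mat s\<close> is
  tested against unit initial values and has to vanish. At \<open>s = 0\<close> the matrix
  \<open>char_mat s\<close> always has the null vector \<open>a\<close>, so a left null vector of
  the reduced matrix is used instead.\<close>

lemma consensus_only_if:
  assumes cons: "\<And>x0 x i. solution x0 x \<Longrightarrow> i < N \<Longrightarrow> (x i \<longlongrightarrow> (\<Sum>j<N. a j * x0 j) / (\<Sum>j<N. a j)) at_top"
    and s: "Re s \<ge> 0"
  shows "det (reduced_mat s) \<noteq> 0"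
proof
  assume det0: "det (reduced_mat s) = 0"
  define e where "e p j = (if j = p then 1 else 0 :: real)" for p j :: nat
  have ae: "(\<Sum>j<N. a j * e p j) = a p" if "p < N" for p
    using that by (simp add: e_def if_distrib[of "\<lambda>z. _ * z"] cong: if_cong)
  have we: "(\<Sum>j<N. w j * complex_of_real (e p j)) = w p" if "p < N" for p w
    using that by (simp add: e_def if_distrib[of "\<lambda>z. _ * z"] if_distrib[of complex_of_real] cong: if_cong)
  have lim: "((\<lambda>T. exp (s * of_real T) * w p) \<longlongrightarrow> (\<Sum>i<N. w i * of_real (a p / (\<Sum>j<N. a j)))) at_top"
    if w: "\<And>j. j < N \<Longrightarrow> (\<Sum>i<N. w i * char_entry s i j) = 0" and p: "p < N" for w p
  proof -
    obtain x where x: "solution (e p) x" using solution_exists by blast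
    show ?thesis
      using left_null_limit[OF x cons[OF x] s w row_sum] by (simp add: ae we p)
  qed
  show False
  proof (cases "s = 0")
    case False
    then have "det (char_mat s) = 0" using det_char_mat[of s] det0 a_pos[of 0] N_pos by auto
    then obtain w where w0: "\<exists>i<N. w i \<noteq> 0" and "\<And>j. j < N \<Longrightarrow> (\<Sum>i<N. w i * char_mat s $$ (i, j)) = 0"
      using det_zero_imp_left_null[OF char_carriers(1)] by metis
    then have w: "(\<Sum>i<N. w i * char_entry s i j) = 0" if "j < N" for j
      using that by (simp add: char_mat_def)
    have "w p = 0" if "p < N" for p
      by (rule exp_tendsto_imp_zero[OF lim[OF w that] s False])
    with w0 show False by auto
  next
    case True
    obtain w where w0: "\<exists>i<N. w i \<noteq> 0" and wr: "\<And>j. j < N \<Longrightarrow> (\<Sum>i<N. w i * reduced_mat s $$ (i, j)) = 0"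
      using det_zero_imp_left_null[OF char_carriers(2) det0] by metis
    \<comment> \<open>At \<open>s = 0\<close> all rows of the reduced matrix except the first sum to
      0. Pairing with the all-ones vector therefore isolates \<open>w 0\<close>, and with
      \<open>w 0 = 0\<close> the vector \<open>w\<close> is also a left null vector of the
      characteristic matrix.\<close>
    have rs: "(\<Sum>j<N. reduced_mat s $$ (i, j)) = (if i = 0 then of_real (\<Sum>j<N. a j) else 0)" if "i < N" for i
      using that char_row_sum[OF that, of s] True by (simp add: reduced_mat_def)
    have "0 = (\<Sum>j<N. \<Sum>i<N. w i * reduced_mat s $$ (i, j))" using wr by simp
    also have "\<dots> = (\<Sum>i<N. w i * (\<Sum>j<N. reduced_mat s $$ (i, j)))"
      unfolding sum_distrib_left by (rule sum.swap)
    also have "\<dots> = w 0 * of_real (\<Sum>j<N. a j)"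
      using N_pos by (simp add: rs if_distrib[of "\<lambda>z. _ * z"] cong: if_cong)
    finally have wz: "w 0 = 0" using sum_a_pos by (auto simp del: of_real_sum)
    have w: "(\<Sum>i<N. w i * char_entry s i j) = 0" if "j < N" for j
    proof -
      have "(\<Sum>i<N. w i * char_entry s i j) = (\<Sum>i<N. w i * reduced_mat s $$ (i, j))"
        using that wz by (intro sum.cong refl) (auto simp: reduced_mat_def)
      then show ?thesis using wr[OF that] by simp
    qed
    \<comment> \<open>For \<open>s = 0\<close> the exponential is constant, so consensus makes
      \<open>w\<close> proportional to \<open>a\<close>; with \<open>w 0 = 0\<close> and
      \<open>a 0 > 0\<close> the factor is 0.\<close>
    have wp: "w p = (\<Sum>i<N. w i) * of_real (a p / (\<Sum>j<N. a j))" if "p < N" for p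
    proof -
      have "w p = (\<Sum>i<N. w i * of_real (a p / (\<Sum>j<N. a j)))"
        using tendsto_unique[OF _ _ lim[OF w that], of "w p"] True by simp
      then show ?thesis by (simp only: sum_distrib_right)
    qed
    from wp[OF N_pos] have "(\<Sum>i<N. w i) = 0"
      using wz sum_a_pos a_pos[OF N_pos] by (auto simp del: of_real_sum)
    then have "w p = 0" if "p < N" for p using wp[OF that] by simp
    with w0 show False by auto
  qed
qed

theorem consensus_iff:
  fixes f defines "f \<equiv> \<lambda>s. det (char_mat s)"
  shows "(\<forall>x0 x. solution x0 x \<longrightarrow> (\<forall>i<N. (x i \<longlongrightarrow> (\<Sum>j<N. a j * x0 j) / (\<Sum>j<N. a j)) at_top))
    \<longleftrightarrow> f 0 = 0 \<and> deriv f 0 \<noteq> 0 \<and> (\<forall>s. f s = 0 \<longrightarrow> s = 0 \<or> Re s < 0)"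
  unfolding f_def characteristic_roots_iff
  using consensus_if consensus_only_if by blast

end

section \<open>The three-layer hierarchy\<close>

definition ones :: "nat \<Rightarrow> real vec" where "ones n = vec n (\<lambda>_. 1)"

lemma ones_carrier [simp]: "ones n \<in> carrier_vec n"
  by (simp add: ones_def)

lemma mult_mat_vec_ones:
  assumes "A \<in> carrier_mat n N" "i < n"
  shows "(A *\<^sub>v ones N) $ i = (\<Sum>j<N. A $$ (i, j))"
  using mult_mat_vec_index_sum[OF assms(1) ones_carrier assms(2)] by (simp add: ones_def)

lemma transpose_mult_mat_vec_index:
  fixes A :: "'a::comm_semiring_0 mat"
  assumes "A \<in> carrier_mat n N" "j < N"
  shows "(transpose_mat A *\<^sub>v vec n a) $ j = (\<Sum>i<n. a i * A $$ (i, j))"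
proof -
  have "(transpose_mat A *\<^sub>v vec n a) $ j = (\<Sum>i<n. transpose_mat A $$ (j, i) * vec n a $ i)"
    using assms by (intro mult_mat_vec_index_sum) auto
  also have "\<dots> = (\<Sum>i<n. a i * A $$ (i, j))"
    using assms by (intro sum.cong) (auto simp: mult.commute)
  finally show ?thesis .
qed

lemma basic_carriers [simp]:
  "laplacian N A \<in> carrier_mat N N" "Kmat N a \<in> carrier_mat N N" "Bmat ks N \<in> carrier_mat N (length ks)"
  by (auto simp: laplacian_def Kmat_def Bmat_def)

lemma laplacian_ones: "laplacian N A *\<^sub>v ones N = 0\<^sub>v N"
proof (rule eq_vecI)
  fix i assume "i < dim_vec (0\<^sub>v N :: real vec)"
  then have i: "i < N" by simp
  let ?S = "\<Sum>l<N. if l \<noteq> i \<and> A i l then 1 else 0 :: real"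
  have "(laplacian N A *\<^sub>v ones N) $ i = (\<Sum>j<N. (if j = i then ?S else 0) - (if j \<noteq> i \<and> A i j then 1 else 0))"
    unfolding mult_mat_vec_ones[OF basic_carriers(1) i] using i
    by (intro sum.cong) (auto simp: laplacian_def)
  also have "\<dots> = 0" using i by (simp add: sum_subtractf)
  finally show "(laplacian N A *\<^sub>v ones N) $ i = 0\<^sub>v N $ i" using i by simp
qed (simp add: laplacian_def)

lemma transpose_laplacian:
  assumes "\<And>i j. A i j \<Longrightarrow> A j i"
  shows "transpose_mat (laplacian N A) = laplacian N A"
  using assms by (intro eq_matI) (auto simp: laplacian_def)

lemma transpose_Kmat_weights:
  assumes "\<And>i. i < N \<Longrightarrow> a i > 0"
  shows "transpose_mat (Kmat N a) *\<^sub>v vec N a = ones N"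
proof (rule eq_vecI)
  fix j assume "j < dim_vec (ones N)"
  then have j: "j < N" by (simp add: ones_def)
  have "(transpose_mat (Kmat N a) *\<^sub>v vec N a) $ j = (\<Sum>i<N. a i * Kmat N a $$ (i, j))"
    by (rule transpose_mult_mat_vec_index[OF basic_carriers(2) j])
  also have "\<dots> = (\<Sum>i<N. if i = j then 1 else 0)"
    using j assms by (intro sum.cong) (auto simp: Kmat_def less_imp_neq[THEN not_sym])
  finally show "(transpose_mat (Kmat N a) *\<^sub>v vec N a) $ j = ones N $ j" using j by (simp add: ones_def)
qed (simp add: Kmat_def ones_def)

text \<open>Aggregation is chosen so that the conserved functional passes through
  \<open>Bmat\<close> and becomes the weight vector of the next layer.\<close>

lemma transpose_Bmat_weights: "transpose_mat (Bmat ks N) *\<^sub>v vec N a = vec (length ks) (agg_weight ks N a)"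
proof (rule eq_vecI)
  fix p assume "p < dim_vec (vec (length ks) (agg_weight ks N a))"
  then have p: "p < length ks" by simp
  have "(transpose_mat (Bmat ks N) *\<^sub>v vec N a) $ p = (\<Sum>i<N. a i * Bmat ks N $$ (i, p))"
    by (rule transpose_mult_mat_vec_index[OF basic_carriers(3) p])
  also have "\<dots> = agg_weight ks N a p"
    unfolding agg_weight_def using p by (intro sum.cong) (auto simp: Bmat_def)
  finally show "(transpose_mat (Bmat ks N) *\<^sub>v vec N a) $ p = vec (length ks) (agg_weight ks N a) $ p"
    using p by simp
qed (simp add: Bmat_def)

lemma valid_C_ones:
  assumes "valid_C ks N C"
  shows "C *\<^sub>v ones N = ones (length ks)"
proof (rule eq_vecI)
  have C: "C \<in> carrier_mat (length ks) N" using assms by (simp add: valid_C_def)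
  fix p assume "p < dim_vec (ones (length ks))"
  then have p: "p < length ks" by (simp add: ones_def)
  show "(C *\<^sub>v ones N) $ p = ones (length ks) $ p"
    unfolding mult_mat_vec_ones[OF C p] using assms p by (simp add: valid_C_def ones_def)
qed (use assms in \<open>auto simp: valid_C_def ones_def\<close>)

text \<open>Group sizes are at least 1, so the first position of group \<open>p\<close> really
  belongs to it and contributes a positive weight.\<close>

lemma agg_weight_pos:
  assumes "valid_partition ks N" "\<And>i. i < N \<Longrightarrow> a i > 0" "p < length ks"
  shows "agg_weight ks N a p > 0"
proof -
  define i where "i = sum_list (take p ks)"
  have "ks ! p \<ge> 1" using assms by (auto simp: valid_partition_def)
  then have g: "in_grp ks p i"
    using assms(3) by (simp add: in_grp_def i_def take_Suc_conv_app_nth)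
  have "sum_list (take (Suc p) ks) + sum_list (drop (Suc p) ks) = N"
    using assms(1) by (simp add: valid_partition_def flip: sum_list_append)
  then have i: "i < N" using g by (simp add: in_grp_def)
  show ?thesis unfolding agg_weight_def
    by (rule sum_pos2[of _ i]) (use g i assms(2) in \<open>auto intro: less_imp_le\<close>)
qed

section \<open>The layer equations as one delay equation\<close>

definition layer_mat :: "real mat \<Rightarrow> real mat \<Rightarrow> real mat \<Rightarrow> nat \<Rightarrow> nat \<Rightarrow> nat \<Rightarrow> real" where
  "layer_mat L1 L2 L3 k i j = [L1, L2, L3] ! k $$ (i, j)"

text \<open>These are round-trip times: a signal passes every link below its layer once upwards and
  once downwards.\<close>

definition layer_delay :: "real \<Rightarrow> real \<Rightarrow> nat \<Rightarrow> real" where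
  "layer_delay \<tau>2 \<tau>3 k = [0, 2 * \<tau>2, 2 * (\<tau>2 + \<tau>3)] ! k"

lemma sum_lessThan_3: "(\<Sum>k<3. f k) = f 0 + f 1 + f (2::nat)" for f :: "nat \<Rightarrow> 'a::comm_monoid_add"
  by (simp add: numeral_eq_Suc lessThan_Suc add_ac)

lemma char_fun_eq:
  assumes "L1 \<in> carrier_mat N N" "L2 \<in> carrier_mat N N" "L3 \<in> carrier_mat N N"
    and sys: "delay_system N 3 (layer_delay \<tau>2 \<tau>3)"
  shows "char_fun N L1 L2 L3 \<tau>2 \<tau>3 s
    = det (mat N N (\<lambda>(i, j). delay_system.char_entry 3 (layer_mat L1 L2 L3) (layer_delay \<tau>2 \<tau>3) s i j))"
  unfolding char_fun_def
proof (rule arg_cong[of _ _ det], rule eq_matI)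
  fix i j
  assume "i < dim_row (mat N N (\<lambda>(i, j). delay_system.char_entry 3 (layer_mat L1 L2 L3) (layer_delay \<tau>2 \<tau>3) s i j))"
    "j < dim_col (mat N N (\<lambda>(i, j). delay_system.char_entry 3 (layer_mat L1 L2 L3) (layer_delay \<tau>2 \<tau>3) s i j))"
  then have ij: "i < N" "j < N" by auto
  show "(s \<cdot>\<^sub>m 1\<^sub>m N + map_mat complex_of_real L1 + exp (- 2 * complex_of_real \<tau>2 * s) \<cdot>\<^sub>m map_mat complex_of_real L2
      + exp (- 2 * complex_of_real (\<tau>2 + \<tau>3) * s) \<cdot>\<^sub>m map_mat complex_of_real L3) $$ (i, j)
    = mat N N (\<lambda>(i, j). delay_system.char_entry 3 (layer_mat L1 L2 L3) (layer_delay \<tau>2 \<tau>3) s i j) $$ (i, j)"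
  proof -
    have "- 2 * complex_of_real \<tau>2 * s = - (of_real (2 * \<tau>2) * s)"
      "- 2 * complex_of_real (\<tau>2 + \<tau>3) * s = - (of_real (2 * (\<tau>2 + \<tau>3)) * s)"
      by (simp_all add: algebra_simps)
    note exponents = this
    show ?thesis
      unfolding exponents using assms(1-3) ij
      by (simp add: delay_system.char_entry_def[OF sys] delay_system.coef_def[OF sys] sum_lessThan_3
          layer_mat_def layer_delay_def mult.commute[of "exp _"] del: of_real_mult of_real_add)
  qed
qed (use assms in auto)

text \<open>Signs are pulled out and products reassociated, which turns the nested signal path into
  the three layer matrices acting on \<open>u\<close>, \<open>v\<close> and \<open>w\<close>, the
  values of the bottom state at three different times.\<close>

lemma feedback_index:
  fixes A1 :: "real mat"
  assumes "A1 \<in> carrier_mat N1 N1" "B1 \<in> carrier_mat N1 N2" "K2 \<in> carrier_mat N2 N2" "LD2 \<in> carrier_mat N2 N2"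
    "C1 \<in> carrier_mat N2 N1" "B2 \<in> carrier_mat N2 N3" "K3 \<in> carrier_mat N3 N3" "LD3 \<in> carrier_mat N3 N3"
    "C2 \<in> carrier_mat N3 N2" and u: "u \<in> carrier_vec N1" "v \<in> carrier_vec N1" "w \<in> carrier_vec N1" and i: "i < N1"
  shows "(- A1 *\<^sub>v u + B1 *\<^sub>v ((- (K2 * LD2)) *\<^sub>v (C1 *\<^sub>v v) + B2 *\<^sub>v ((- (K3 * LD3)) *\<^sub>v (C2 *\<^sub>v (C1 *\<^sub>v w))))) $ i
    = - ((\<Sum>j<N1. A1 $$ (i, j) * u $ j) + (\<Sum>j<N1. (B1 * K2 * LD2 * C1) $$ (i, j) * v $ j)
      + (\<Sum>j<N1. (B1 * B2 * K3 * LD3 * C2 * C1) $$ (i, j) * w $ j))"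
proof -
  have c [simp]: "C1 *\<^sub>v v \<in> carrier_vec N2" "C1 *\<^sub>v w \<in> carrier_vec N2" "C2 *\<^sub>v (C1 *\<^sub>v w) \<in> carrier_vec N3"
    "K2 * LD2 \<in> carrier_mat N2 N2" "K3 * LD3 \<in> carrier_mat N3 N3" "B1 * K2 \<in> carrier_mat N1 N2"
    "B1 * K2 * LD2 \<in> carrier_mat N1 N2" "B1 * K2 * LD2 * C1 \<in> carrier_mat N1 N1"
    "B1 * B2 \<in> carrier_mat N1 N3" "B1 * B2 * K3 \<in> carrier_mat N1 N3" "B1 * B2 * K3 * LD3 \<in> carrier_mat N1 N3"
    "B1 * B2 * K3 * LD3 * C2 \<in> carrier_mat N1 N2" "B1 * B2 * K3 * LD3 * C2 * C1 \<in> carrier_mat N1 N1"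
    using assms by auto
  define p where "p = B1 * K2 * LD2 * C1 *\<^sub>v v"
  define q where "q = B1 * B2 * K3 * LD3 * C2 * C1 *\<^sub>v w"
  have pc: "p \<in> carrier_vec N1" "q \<in> carrier_vec N1"
    unfolding p_def q_def by (rule mult_mat_vec_carrier[OF c(8) u(2)] mult_mat_vec_carrier[OF c(13) u(3)])+
  have "B1 *\<^sub>v ((- (K2 * LD2)) *\<^sub>v (C1 *\<^sub>v v)) = - p"
  proof -
    have "p = B1 * (K2 * LD2) *\<^sub>v (C1 *\<^sub>v v)"
      unfolding p_def assoc_mult_mat[OF assms(2,3,4), symmetric]
      by (rule assoc_mult_mat_vec[OF c(7) assms(5) u(2)])
    also have "- \<dots> = - (B1 * (K2 * LD2)) *\<^sub>v (C1 *\<^sub>v v)"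
      using assms by (intro uminus_mult_mat_vec[symmetric]) auto
    also have "\<dots> = B1 * (- (K2 * LD2)) *\<^sub>v (C1 *\<^sub>v v)"
      using assms by (subst uminus_mult_right_mat) auto
    also have "\<dots> = B1 *\<^sub>v ((- (K2 * LD2)) *\<^sub>v (C1 *\<^sub>v v))"
      using assms by (intro assoc_mult_mat_vec[of _ N1 N2 _ N2]) auto
    finally show ?thesis by simp
  qed
  moreover have "B1 *\<^sub>v (B2 *\<^sub>v ((- (K3 * LD3)) *\<^sub>v (C2 *\<^sub>v (C1 *\<^sub>v w)))) = - q"
  proof -
    have "q = B1 * B2 * (K3 * LD3) *\<^sub>v (C2 *\<^sub>v (C1 *\<^sub>v w))"
      unfolding q_def assoc_mult_mat[OF c(9) assms(7,8), symmetric]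
      by (simp only: assoc_mult_mat_vec[OF c(12) assms(5) u(3)] assoc_mult_mat_vec[OF c(11) assms(9) c(2)])
    also have "- \<dots> = - (B1 * B2 * (K3 * LD3)) *\<^sub>v (C2 *\<^sub>v (C1 *\<^sub>v w))"
      using assms by (intro uminus_mult_mat_vec[symmetric]) auto
    also have "\<dots> = B1 * B2 * (- (K3 * LD3)) *\<^sub>v (C2 *\<^sub>v (C1 *\<^sub>v w))"
      using assms by (subst uminus_mult_right_mat) auto
    also have "\<dots> = B1 * B2 *\<^sub>v ((- (K3 * LD3)) *\<^sub>v (C2 *\<^sub>v (C1 *\<^sub>v w)))"
      using assms by (intro assoc_mult_mat_vec[of _ N1 N3 _ N3]) auto
    also have "\<dots> = B1 *\<^sub>v (B2 *\<^sub>v ((- (K3 * LD3)) *\<^sub>v (C2 *\<^sub>v (C1 *\<^sub>v w))))"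
      using assms by (intro assoc_mult_mat_vec[of _ N1 N2 _ N3]) auto
    finally show ?thesis by simp
  qed
  moreover have "B1 *\<^sub>v ((- (K2 * LD2)) *\<^sub>v (C1 *\<^sub>v v) + B2 *\<^sub>v ((- (K3 * LD3)) *\<^sub>v (C2 *\<^sub>v (C1 *\<^sub>v w))))
      = B1 *\<^sub>v ((- (K2 * LD2)) *\<^sub>v (C1 *\<^sub>v v)) + B1 *\<^sub>v (B2 *\<^sub>v ((- (K3 * LD3)) *\<^sub>v (C2 *\<^sub>v (C1 *\<^sub>v w))))"
    using assms by (intro mult_add_distrib_mat_vec[of _ N1 N2]) auto
  moreover have "- A1 *\<^sub>v u = - (A1 *\<^sub>v u)"
    using assms by (intro uminus_mult_mat_vec) auto
  ultimately have "(- A1 *\<^sub>v u + B1 *\<^sub>v ((- (K2 * LD2)) *\<^sub>v (C1 *\<^sub>v v) + B2 *\<^sub>v ((- (K3 * LD3)) *\<^sub>v (C2 *\<^sub>v (C1 *\<^sub>v w))))) $ i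
      = (- (A1 *\<^sub>v u) + (- p + - q)) $ i" by simp
  also have "\<dots> = - ((A1 *\<^sub>v u) $ i + p $ i + q $ i)"
    using pc assms(1) i by simp
  finally show ?thesis
    unfolding p_def q_def
      mult_mat_vec_index_sum[OF assms(1) u(1) i] mult_mat_vec_index_sum[OF c(8) u(2) i] mult_mat_vec_index_sum[OF c(13) u(3) i] .
qed

lemma mult_zero_vec: "A \<in> carrier_mat n k \<Longrightarrow> A *\<^sub>v 0\<^sub>v k = (0\<^sub>v n :: real vec)"
  by (intro eq_vecI) auto

lemma transpose_mult_vec:
  assumes "A \<in> carrier_mat n k" "B \<in> carrier_mat k l" "v \<in> carrier_vec n"
  shows "transpose_mat (A * B) *\<^sub>v v = transpose_mat B *\<^sub>v (transpose_mat A *\<^sub>v (v :: real vec))"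
  unfolding transpose_mult[OF assms(1,2)]
  by (rule assoc_mult_mat_vec[of _ l k _ n]) (use assms in auto)

lemma less_3_cases: "k < 3 \<Longrightarrow> k = 0 \<or> k = 1 \<or> k = (2::nat)"
  by auto

section \<open>The hierarchy as a consensus system\<close>

locale hierarchy =
  fixes N1 N2 N3 :: nat and k1 k2 :: "nat list" and A1 A2 A3 :: "nat \<Rightarrow> nat \<Rightarrow> bool"
    and a :: "nat \<Rightarrow> real" and C1 C2 :: "real mat" and \<tau>2 \<tau>3 :: real
  assumes N1: "N1 > 0" and k1: "length k1 = N2" "valid_partition k1 N1" and k2: "length k2 = N3" "valid_partition k2 N2"
    and sym: "\<And>i j. A1 i j \<Longrightarrow> A1 j i" "\<And>i j. A2 i j \<Longrightarrow> A2 j i" "\<And>i j. A3 i j \<Longrightarrow> A3 j i"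
    and a: "\<And>i. i < N1 \<Longrightarrow> a i > 0" and C1: "valid_C k1 N1 C1" and C2: "valid_C k2 N2 C2"
    and \<tau>: "\<tau>2 \<ge> 0" "\<tau>3 \<ge> 0"
begin

definition "a2 = agg_weight k1 N1 a"
definition "a3 = agg_weight k2 N2 a2"
definition "K1 = Kmat N1 a"
definition "K2 = Kmat N2 a2"
definition "K3 = Kmat N3 a3"
definition "LD1 = laplacian N1 A1"
definition "LD2 = laplacian N2 A2"
definition "LD3 = laplacian N3 A3"
definition "B1 = Bmat k1 N1"
definition "B2 = Bmat k2 N2"
definition "L1 = K1 * LD1"
definition "L2 = B1 * K2 * LD2 * C1"
definition "L3 = B1 * B2 * K3 * LD3 * C2 * C1"

lemma layer_carriers [simp]:
  "K1 \<in> carrier_mat N1 N1" "K2 \<in> carrier_mat N2 N2" "K3 \<in> carrier_mat N3 N3"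
  "LD1 \<in> carrier_mat N1 N1" "LD2 \<in> carrier_mat N2 N2" "LD3 \<in> carrier_mat N3 N3"
  "B1 \<in> carrier_mat N1 N2" "B2 \<in> carrier_mat N2 N3" "C1 \<in> carrier_mat N2 N1" "C2 \<in> carrier_mat N3 N2"
  using basic_carriers(3)[of k1 N1] basic_carriers(3)[of k2 N2] k1 k2 C1 C2
  by (auto simp: K1_def K2_def K3_def LD1_def LD2_def LD3_def B1_def B2_def valid_C_def simp del: basic_carriers(3))

lemma product_carriers [simp]:
  "L1 \<in> carrier_mat N1 N1" "B1 * K2 \<in> carrier_mat N1 N2" "B1 * K2 * LD2 \<in> carrier_mat N1 N2" "L2 \<in> carrier_mat N1 N1"
  "B1 * B2 \<in> carrier_mat N1 N3" "B1 * B2 * K3 \<in> carrier_mat N1 N3" "B1 * B2 * K3 * LD3 \<in> carrier_mat N1 N3"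
  "B1 * B2 * K3 * LD3 * C2 \<in> carrier_mat N1 N2" "L3 \<in> carrier_mat N1 N1"
  unfolding L1_def L2_def L3_def by (rule mult_carrier_mat layer_carriers)+

lemma averaging_ones: "C1 *\<^sub>v ones N1 = ones N2" "C2 *\<^sub>v ones N2 = ones N3"
  using valid_C_ones[OF C1] valid_C_ones[OF C2] k1 k2 by simp_all

lemma LD_ones: "LD1 *\<^sub>v ones N1 = 0\<^sub>v N1" "LD2 *\<^sub>v ones N2 = 0\<^sub>v N2" "LD3 *\<^sub>v ones N3 = 0\<^sub>v N3"
  unfolding LD1_def LD2_def LD3_def by (rule laplacian_ones)+

text \<open>Read from the right, each averaging matrix maps the all-ones vector to that of the next
  layer until a Laplacian annihilates it.\<close>

lemma L_ones: "L1 *\<^sub>v ones N1 = 0\<^sub>v N1" "L2 *\<^sub>v ones N1 = 0\<^sub>v N1" "L3 *\<^sub>v ones N1 = 0\<^sub>v N1"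
proof -
  show "L1 *\<^sub>v ones N1 = 0\<^sub>v N1"
    unfolding L1_def by (subst assoc_mult_mat_vec[of _ N1 N1 _ N1]) (simp_all add: LD_ones mult_zero_vec[of _ N1])
  have "L2 *\<^sub>v ones N1 = B1 * K2 * LD2 *\<^sub>v (C1 *\<^sub>v ones N1)"
    unfolding L2_def by (rule assoc_mult_mat_vec[OF product_carriers(3) layer_carriers(9) ones_carrier])
  also have "\<dots> = B1 * K2 *\<^sub>v (LD2 *\<^sub>v ones N2)"
    unfolding averaging_ones by (rule assoc_mult_mat_vec[OF product_carriers(2) layer_carriers(5) ones_carrier])
  finally show "L2 *\<^sub>v ones N1 = 0\<^sub>v N1" unfolding LD_ones mult_zero_vec[OF product_carriers(2)] .
  have "L3 *\<^sub>v ones N1 = B1 * B2 * K3 * LD3 * C2 *\<^sub>v (C1 *\<^sub>v ones N1)"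
    unfolding L3_def by (rule assoc_mult_mat_vec[OF product_carriers(8) layer_carriers(9) ones_carrier])
  also have "\<dots> = B1 * B2 * K3 * LD3 *\<^sub>v (C2 *\<^sub>v ones N2)"
    unfolding averaging_ones(1) by (rule assoc_mult_mat_vec[OF product_carriers(7) layer_carriers(10) ones_carrier])
  also have "\<dots> = B1 * B2 * K3 *\<^sub>v (LD3 *\<^sub>v ones N3)"
    unfolding averaging_ones by (rule assoc_mult_mat_vec[OF product_carriers(6) layer_carriers(6) ones_carrier])
  finally show "L3 *\<^sub>v ones N1 = 0\<^sub>v N1" unfolding LD_ones mult_zero_vec[OF product_carriers(6)] .
qed

lemma weights_pos: "p < N2 \<Longrightarrow> a2 p > 0" "q < N3 \<Longrightarrow> a3 q > 0"
proof -
  show a2: "a2 p > 0" if "p < N2" for p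
    unfolding a2_def using k1 a that by (intro agg_weight_pos) auto
  show "q < N3 \<Longrightarrow> a3 q > 0"
    unfolding a3_def using k2 a2 by (intro agg_weight_pos) auto
qed

lemma left_actions:
  "transpose_mat B1 *\<^sub>v vec N1 a = vec N2 a2" "transpose_mat B2 *\<^sub>v vec N2 a2 = vec N3 a3"
  "transpose_mat K1 *\<^sub>v vec N1 a = ones N1" "transpose_mat K2 *\<^sub>v vec N2 a2 = ones N2" "transpose_mat K3 *\<^sub>v vec N3 a3 = ones N3"
  "transpose_mat LD1 *\<^sub>v ones N1 = 0\<^sub>v N1" "transpose_mat LD2 *\<^sub>v ones N2 = 0\<^sub>v N2" "transpose_mat LD3 *\<^sub>v ones N3 = 0\<^sub>v N3"
  using transpose_Bmat_weights[of k1 N1 a] transpose_Bmat_weights[of k2 N2 a2] k1 k2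
    transpose_Kmat_weights[of N1 a, OF a] transpose_Kmat_weights[of N2 a2, OF weights_pos(1)] transpose_Kmat_weights[of N3 a3, OF weights_pos(2)]
    transpose_laplacian[of A1, OF sym(1)] transpose_laplacian[of A2, OF sym(2)] transpose_laplacian[of A3, OF sym(3)] laplacian_ones
  by (simp_all add: B1_def B2_def K1_def K2_def K3_def LD1_def LD2_def LD3_def a2_def a3_def)

text \<open>Read from the left, the weights pass up through the \<open>B\<close> matrices, the
  inverse weights in \<open>K\<close> turn them into the all-ones vector, and the symmetric
  Laplacian annihilates it.\<close>

lemma L_weights: "transpose_mat L1 *\<^sub>v vec N1 a = 0\<^sub>v N1" "transpose_mat L2 *\<^sub>v vec N1 a = 0\<^sub>v N1" "transpose_mat L3 *\<^sub>v vec N1 a = 0\<^sub>v N1"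
proof -
  have v: "vec N1 a \<in> carrier_vec N1" by simp
  have t: "transpose_mat C1 \<in> carrier_mat N1 N2" "transpose_mat C2 \<in> carrier_mat N2 N3" using layer_carriers by simp_all
  show "transpose_mat L1 *\<^sub>v vec N1 a = 0\<^sub>v N1"
    unfolding L1_def transpose_mult_vec[OF layer_carriers(1) layer_carriers(4) v] left_actions ..
  show "transpose_mat L2 *\<^sub>v vec N1 a = 0\<^sub>v N1"
    unfolding L2_def transpose_mult_vec[OF product_carriers(3) layer_carriers(9) v] transpose_mult_vec[OF product_carriers(2) layer_carriers(5) v]
      transpose_mult_vec[OF layer_carriers(7) layer_carriers(2) v] left_actions by (rule mult_zero_vec[OF t(1)])
  show "transpose_mat L3 *\<^sub>v vec N1 a = 0\<^sub>v N1"
    unfolding L3_def transpose_mult_vec[OF product_carriers(8) layer_carriers(9) v] transpose_mult_vec[OF product_carriers(7) layer_carriers(10) v]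
      transpose_mult_vec[OF product_carriers(6) layer_carriers(6) v] transpose_mult_vec[OF product_carriers(5) layer_carriers(3) v] transpose_mult_vec[OF layer_carriers(7) layer_carriers(8) v]
      left_actions mult_zero_vec[OF t(2)] by (rule mult_zero_vec[OF t(1)])
qed

sublocale S: consensus_system N1 3 "layer_mat L1 L2 L3" "layer_delay \<tau>2 \<tau>3" a
proof
  show "layer_delay \<tau>2 \<tau>3 k \<ge> 0" if "k < 3" for k
    using less_3_cases[OF that] \<tau> by (auto simp: layer_delay_def)
  show "(\<Sum>j<N1. layer_mat L1 L2 L3 k i j) = 0" if "k < 3" "i < N1" for k i
  proof -
    have "(\<Sum>j<N1. M $$ (i, j)) = 0" if "M \<in> carrier_mat N1 N1" "M *\<^sub>v ones N1 = 0\<^sub>v N1" for M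
      using mult_mat_vec_ones[OF that(1) \<open>i < N1\<close>] that(2) \<open>i < N1\<close> by simp
    then show ?thesis using less_3_cases[OF that(1)] L_ones by (auto simp: layer_mat_def)
  qed
  show "(\<Sum>i<N1. a i * layer_mat L1 L2 L3 k i j) = 0" if "k < 3" "j < N1" for k j
  proof -
    have "(\<Sum>i<N1. a i * M $$ (i, j)) = 0" if "M \<in> carrier_mat N1 N1" "transpose_mat M *\<^sub>v vec N1 a = 0\<^sub>v N1" for M
      using transpose_mult_mat_vec_index[OF that(1) \<open>j < N1\<close>, of a] that(2) \<open>j < N1\<close> by simp
    then show ?thesis using less_3_cases[OF that(1)] L_weights by (auto simp: layer_mat_def)
  qed
qed (use N1 a in auto)

lemma char_fun_char_mat: "char_fun N1 L1 L2 L3 \<tau>2 \<tau>3 s = det (S.char_mat s)"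
  unfolding S.char_mat_def by (rule char_fun_eq) (simp_all add: S.delay_system_axioms)

text \<open>This is \<open>y1\<close> with all auxiliary signals substituted; the delays are
  subtracted one by one in the order of substitution.\<close>

definition feedback :: "(real \<Rightarrow> real vec) \<Rightarrow> real \<Rightarrow> real vec" where
  "feedback x t = B1 *\<^sub>v ((- (K2 * LD2)) *\<^sub>v (C1 *\<^sub>v x (t - \<tau>2 - \<tau>2))
    + B2 *\<^sub>v ((- (K3 * LD3)) *\<^sub>v (C2 *\<^sub>v (C1 *\<^sub>v x (t - \<tau>2 - \<tau>3 - \<tau>3 - \<tau>2)))))"

lemma feedback_rhs:
  fixes x :: "real \<Rightarrow> real vec"
  assumes "\<And>t. x t \<in> carrier_vec N1" "i < N1"
  shows "((- (K1 * LD1)) *\<^sub>v x t + feedback x t) $ i = S.rhs (\<lambda>i t. x t $ i) i t"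
proof -
  have times: "t - \<tau>2 - \<tau>2 = t - 2 * \<tau>2" "t - \<tau>2 - \<tau>3 - \<tau>3 - \<tau>2 = t - 2 * (\<tau>2 + \<tau>3)" by simp_all
  have "((- (K1 * LD1)) *\<^sub>v x t + feedback x t) $ i
      = - ((\<Sum>j<N1. L1 $$ (i, j) * x t $ j) + (\<Sum>j<N1. L2 $$ (i, j) * x (t - 2 * \<tau>2) $ j)
        + (\<Sum>j<N1. L3 $$ (i, j) * x (t - 2 * (\<tau>2 + \<tau>3)) $ j))"
    unfolding feedback_def times L1_def[symmetric] L2_def L3_def
    by (rule feedback_index[OF product_carriers(1) layer_carriers(7,2,5,9,8,3,6,10) assms(1,1,1,2)])
  also have "\<dots> = S.rhs (\<lambda>i t. x t $ i) i t"
    by (simp add: S.rhs_def sum_lessThan_3 layer_mat_def layer_delay_def)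
  finally show ?thesis .
qed

abbreviation "system \<equiv> delayed_solution K1 LD1 K2 LD2 K3 LD3 B1 B2 C1 C2 \<tau>2 \<tau>3 N1 N2 N3"

text \<open>The algebraic equations are prescribed for \<open>t \<ge> 0\<close> only, while
  substitution evaluates them at delayed, possibly negative times. They extend to all times because
  both sides vanish there.\<close>

lemma system_imp_solution:
  fixes x0 :: "real vec" and x1 :: "real \<Rightarrow> real vec"
  assumes "system x0 x1 x2 x3 y1 y2"
  shows "S.solution (\<lambda>i. x0 $ i) (\<lambda>i t. x1 t $ i)"
proof -
  note h = assms[unfolded delayed_solution_def]
  have x1c: "x1 t \<in> carrier_vec N1" for t using h by auto
  have neg: "x1 t = 0\<^sub>v N1" "x2 t = 0\<^sub>v N2" "x3 t = 0\<^sub>v N3" "y2 t = 0\<^sub>v N2" if "t < 0" for t using h that by auto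
  have x2: "x2 t = C1 *\<^sub>v x1 (t - \<tau>2)" for t
    using h neg(1)[of "t - \<tau>2"] neg(2)[of t] mult_zero_vec[OF layer_carriers(9)] \<tau> by (cases "t < 0") auto
  have x3: "x3 t = C2 *\<^sub>v x2 (t - \<tau>3)" for t
    using h neg(2)[of "t - \<tau>3"] neg(3)[of t] mult_zero_vec[OF layer_carriers(10)] \<tau> by (cases "t < 0") auto
  have KL: "- (K3 * LD3) \<in> carrier_mat N3 N3" using mult_carrier_mat[OF layer_carriers(3) layer_carriers(6)] by simp
  have y2: "y2 t = B2 *\<^sub>v ((- (K3 * LD3)) *\<^sub>v x3 (t - \<tau>3))" for t
    using h neg(3)[of "t - \<tau>3"] neg(4)[of t] mult_zero_vec[OF layer_carriers(8)] mult_zero_vec[OF KL] \<tau>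
    by (cases "t < 0") (auto simp del: uminus_mult_mat_vec)
  have y1: "y1 t = feedback x1 t" if "t \<ge> 0" for t
  proof -
    have "y1 t = B1 *\<^sub>v ((- (K2 * LD2)) *\<^sub>v x2 (t - \<tau>2) + y2 (t - \<tau>2))" using h that by auto
    then show ?thesis unfolding feedback_def x2 y2 x3 .
  qed
  have "(S.rhs (\<lambda>i t. x1 t $ i) i has_integral (x1 t $ i - x0 $ i)) {0..t}" if "i < N1" "t \<ge> 0" for i t
  proof -
    have "((\<lambda>s. ((- (K1 * LD1)) *\<^sub>v x1 s + y1 s) $ i) has_integral (x1 t $ i - x0 $ i)) {0..t}"
      using h that by blast
    then show ?thesis
      by (rule has_integral_eq[rotated]) (simp only: atLeastAtMost_iff y1 feedback_rhs[where x = x1, OF x1c that(1)])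
  qed
  then show ?thesis using neg(1) by (auto simp: S.solution_def)
qed

text \<open>Conversely the auxiliary signals are defined by their equations at all times. Thus
  consensus for the hierarchy covers every solution of the delay equation, which the necessity
  direction requires.\<close>

lemma solution_imp_system:
  assumes sol: "S.solution x0 x"
  defines "x1 \<equiv> \<lambda>t. vec N1 (\<lambda>i. x i t)"
  shows "\<exists>x2 x3 y1 y2. system (vec N1 x0) x1 x2 x3 y1 y2"
proof -
  define x2 where "x2 t = C1 *\<^sub>v x1 (t - \<tau>2)" for t
  define x3 where "x3 t = C2 *\<^sub>v x2 (t - \<tau>3)" for t
  define y2 where "y2 t = B2 *\<^sub>v ((- (K3 * LD3)) *\<^sub>v x3 (t - \<tau>3))" for t
  define y1 where "y1 t = B1 *\<^sub>v ((- (K2 * LD2)) *\<^sub>v x2 (t - \<tau>2) + y2 (t - \<tau>2))" for t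
  have y1_eq: "y1 = feedback x1" by (simp add: fun_eq_iff y1_def y2_def x3_def x2_def feedback_def)
  have KL: "- (K2 * LD2) \<in> carrier_mat N2 N2" "- (K3 * LD3) \<in> carrier_mat N3 N3"
    using mult_carrier_mat[OF layer_carriers(2) layer_carriers(5)] mult_carrier_mat[OF layer_carriers(3) layer_carriers(6)] by simp_all
  have c: "x1 t \<in> carrier_vec N1" "x2 t \<in> carrier_vec N2" "x3 t \<in> carrier_vec N3" "y2 t \<in> carrier_vec N2" "y1 t \<in> carrier_vec N1" for t
  proof -
    show x1: "x1 t \<in> carrier_vec N1" for t by (simp add: x1_def)
    show x2: "x2 t \<in> carrier_vec N2" for t unfolding x2_def by (rule mult_mat_vec_carrier[OF layer_carriers(9) x1])
    show x3: "x3 t \<in> carrier_vec N3" for t unfolding x3_def by (rule mult_mat_vec_carrier[OF layer_carriers(10) x2])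
    show y2: "y2 t \<in> carrier_vec N2" for t
      unfolding y2_def by (rule mult_mat_vec_carrier[OF layer_carriers(8) mult_mat_vec_carrier[OF KL(2) x3]])
    show "y1 t \<in> carrier_vec N1"
      unfolding y1_def by (rule mult_mat_vec_carrier[OF layer_carriers(7) add_carrier_vec[OF mult_mat_vec_carrier[OF KL(1) x2] y2]])
  qed
  have x1_neg: "x1 t = 0\<^sub>v N1" if "t < 0" for t
    using that S.sol_neg[OF sol] by (auto simp: x1_def)
  have x2_neg: "x2 t = 0\<^sub>v N2" if "t < 0" for t
    unfolding x2_def using that \<tau> mult_zero_vec[OF layer_carriers(9)] by (simp add: x1_neg)
  have x3_neg: "x3 t = 0\<^sub>v N3" if "t < 0" for t
    unfolding x3_def using that \<tau> mult_zero_vec[OF layer_carriers(10)] by (simp add: x2_neg)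
  have y2_neg: "y2 t = 0\<^sub>v N2" if "t < 0" for t
    unfolding y2_def using that \<tau> by (simp add: x3_neg mult_zero_vec[OF KL(2)] mult_zero_vec[OF layer_carriers(8)] del: uminus_mult_mat_vec)
  have y1_neg: "y1 t = 0\<^sub>v N1" if "t < 0" for t
    unfolding y1_def using that \<tau> by (simp add: x2_neg y2_neg mult_zero_vec[OF KL(1)] mult_zero_vec[OF layer_carriers(7)] del: uminus_mult_mat_vec)
  have rhs: "((- (K1 * LD1)) *\<^sub>v x1 s + y1 s) $ i = S.rhs x i s" if "i < N1" for i s
  proof -
    have "((- (K1 * LD1)) *\<^sub>v x1 s + y1 s) $ i = S.rhs (\<lambda>i t. x1 t $ i) i s"
      unfolding y1_eq by (rule feedback_rhs[OF c(1) that])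
    also have "\<dots> = S.rhs x i s"
      unfolding S.rhs_def x1_def by simp
    finally show ?thesis .
  qed
  have "system (vec N1 x0) x1 x2 x3 y1 y2"
    unfolding delayed_solution_def
  proof (intro conjI allI impI)
    show "x1 0 = vec N1 x0"
      using S.sol_integral(2)[OF sol, of _ 0] by (auto simp: x1_def)
    show "((\<lambda>s. ((- (K1 * LD1)) *\<^sub>v x1 s + y1 s) $ i) has_integral (x1 t $ i - vec N1 x0 $ i)) {0..t}"
      if "t \<ge> 0" "i < N1" for t i
      unfolding rhs[OF that(2)] using sol that by (simp add: S.solution_def x1_def)
  qed (simp_all only: c x1_neg x2_neg x3_neg y1_neg y2_neg, simp_all only: x2_def x3_def y1_def y2_def)
  then show ?thesis by blast
qed

theorem hierarchy_consensus_iff: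
  "(\<forall>x0 \<in> carrier_vec N1. \<forall>x1 x2 x3 y1 y2. system x0 x1 x2 x3 y1 y2 \<longrightarrow>
      (\<forall>i<N1. ((\<lambda>t. x1 t $ i) \<longlongrightarrow> (\<Sum>j<N1. a j * x0 $ j) / (\<Sum>j<N1. a j)) at_top))
    \<longleftrightarrow> (let f = char_fun N1 L1 L2 L3 \<tau>2 \<tau>3
          in f 0 = 0 \<and> deriv f 0 \<noteq> 0 \<and> (\<forall>s. f s = 0 \<longrightarrow> s = 0 \<or> Re s < 0))" (is "?lhs = _")
proof -
  have "char_fun N1 L1 L2 L3 \<tau>2 \<tau>3 = (\<lambda>s. det (S.char_mat s))"
    by (simp add: fun_eq_iff char_fun_char_mat)
  moreover have "?lhs \<longleftrightarrow> (\<forall>x0 x. S.solution x0 x \<longrightarrow>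
      (\<forall>i<N1. (x i \<longlongrightarrow> (\<Sum>j<N1. a j * x0 j) / (\<Sum>j<N1. a j)) at_top))" (is "_ = ?rhs")
  proof
    assume l: ?lhs
    show ?rhs
    proof (intro allI impI)
      fix x0 x i assume sol: "S.solution x0 x" and i: "i < N1"
      obtain x2 x3 y1 y2 where "system (vec N1 x0) (\<lambda>t. vec N1 (\<lambda>i. x i t)) x2 x3 y1 y2"
        using solution_imp_system[OF sol] by blast
      with l have "((\<lambda>t. vec N1 (\<lambda>i. x i t) $ i) \<longlongrightarrow> (\<Sum>j<N1. a j * vec N1 x0 $ j) / (\<Sum>j<N1. a j)) at_top"
        using i vec_carrier[of N1 x0] by blast
      then show "(x i \<longlongrightarrow> (\<Sum>j<N1. a j * x0 j) / (\<Sum>j<N1. a j)) at_top"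
        using i by simp
    qed
  next
    assume ?rhs
    then show ?lhs using system_imp_solution by blast
  qed
  ultimately show ?thesis using S.consensus_iff by (simp add: Let_def)
qed

end

theorem theorem4:
  fixes N1 N2 N3 :: nat and k1 k2 :: "nat list"
    and A1 A2 A3 :: "nat \<Rightarrow> nat \<Rightarrow> bool"
    and a :: "nat \<Rightarrow> real" and C1 C2 :: "real mat" and \<tau>2 \<tau>3 :: real
  assumes "N1 > 0" and "N2 > 0" and "N3 > 0"
    and "length k1 = N2" and "valid_partition k1 N1"
    and "length k2 = N3" and "valid_partition k2 N2"
    and "group_graphs k1 A1" and "group_graphs k2 A2" and "group_graphs [N3] A3"
    and "\<forall>i<N1. a i > 0"
    and "valid_C k1 N1 C1" and "valid_C k2 N2 C2"
    and "\<tau>2 \<ge> 0" and "\<tau>3 \<ge> 0"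
  defines "K1 \<equiv> Kmat N1 a" and "K2 \<equiv> Kmat N2 (agg_weight k1 N1 a)"
    and "K3 \<equiv> Kmat N3 (agg_weight k2 N2 (agg_weight k1 N1 a))"
    and "LD1 \<equiv> laplacian N1 A1" and "LD2 \<equiv> laplacian N2 A2" and "LD3 \<equiv> laplacian N3 A3"
    and "B1 \<equiv> Bmat k1 N1" and "B2 \<equiv> Bmat k2 N2"
  shows "(\<forall>x0 \<in> carrier_vec N1. \<forall>x1 x2 x3 y1 y2.
            delayed_solution K1 LD1 K2 LD2 K3 LD3 B1 B2 C1 C2 \<tau>2 \<tau>3 N1 N2 N3 x0 x1 x2 x3 y1 y2 \<longrightarrow>
            (\<forall>i<N1. ((\<lambda>t. x1 t $ i) \<longlongrightarrow> (\<Sum>j<N1. a j * x0 $ j) / (\<Sum>j<N1. a j)) at_top))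
         \<longleftrightarrow>
         (let f = char_fun N1 (K1 * LD1) (B1 * K2 * LD2 * C1) (B1 * B2 * K3 * LD3 * C2 * C1) \<tau>2 \<tau>3
          in f 0 = 0 \<and> deriv f 0 \<noteq> 0 \<and> (\<forall>s. f s = 0 \<longrightarrow> s = 0 \<or> Re s < 0))"
proof -
  interpret H: hierarchy N1 N2 N3 k1 k2 A1 A2 A3 a C1 C2 \<tau>2 \<tau>3
    using assms(1-15) by unfold_locales (auto simp: group_graphs_def)
  show ?thesis
    using H.hierarchy_consensus_iff
    unfolding H.K1_def H.K2_def H.K3_def H.LD1_def H.LD2_def H.LD3_def H.B1_def H.B2_def
      H.L1_def H.L2_def H.L3_def H.a2_def H.a3_def
      K1_def K2_def K3_def LD1_def LD2_def LD3_def B1_def B2_def .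
qed

end
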